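(* Every proper $K$-poset $V$ has a simplification; that is, there exist a finite integer $\ell\ge0$, proper $K$-posets $V_0=V,V_1,\dots,V_\ell$, and for each $1\le i\le\ell$ a maximal node $n_i$ of $V_{i-1}$ of positive height such that $V_i$ is a splitting of $V_{i-1}$ at $n_i$, with $V_\ell$ simple.
   Context: For a poset $U$: $L(u)=L_U(u)=\{v\le u\}$, $G(u)=\{v\ge u\}$, $L(u)^*,G(u)^*$ these with $u$ removed; height of $u$ is $\dim L(u)$ (dimension = supremum of chain lengths); $H_i$ = height-$i$ nodes; $\operatorname{mub}A$ = minimal common upper bounds; $[b/c]$ = set of $u$ with $G(u)^*=\{b\}$, $L(u)^*=\{c\}$. A poset with $\dim\le2$ is a $K$-poset if $\min U$, $H_2$ are finite, $\operatorname{mub}\{u,v\}$ is finite for distinct minimal $u,v$, and $[u/w]$ is infinite whenever $u>v>w$ for some $v$; proper if $|[u/w]|\in\{0,|U|\}$ for all maximal $u$, minimal $w$. $\mathcal H_U$ = minimal nodes plus height-one nodes dominating at least two minimal nodes. For a poset $W$ with single maximal node $n$ and $\dim W\ge1$: $\mathcal H_W^*=\mathcal H_W\setminus\{n\}$; $\Lambda_W$ = $(H_1\cap\mathcal H_W^* )$ together with all $v\in\mathcal H_W^*$ with $G(v)\cap H_1\cap\mathcal H_W^*=\emptyset$; $d_W(n)=|\Lambda_W|$. A proper $K$-poset $V$ is simple if $d_{L_V(m)}(m)=1$ for every maximal $m$ of positive height. Splitting: for a poset $V$ with a maximal node $m$ of positive height, $U$ is a splitting of $V$ at $m$ if there are a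 finite nonempty $\mathcal M\subseteq\max U$ of positive-height nodes and a surjective order-preserving $\varphi:U\to V$ with $\varphi^{-1}(m)=\mathcal M$, $|\varphi^{-1}(v)|=1$ for $v\ne m$, and whenever $\varphi(x')=x\le y$ there is $y'\ge x'$ with $\varphi(y')=y$. *)

theory Defs
  imports Main "HOL-Library.Extended_Nat" "HOL-Library.Equipollence"
begin

definition poset :: "'a set \<Rightarrow> ('a \<Rightarrow> 'a \<Rightarrow> bool) \<Rightarrow> bool" where
  "poset U le \<longleftrightarrow>
     (\<forall>x\<in>U. le x x) \<and>
     (\<forall>x\<in>U. \<forall>y\<in>U. le x y \<and> le y x \<longrightarrow> x = y) \<and>
     (\<forall>x\<in>U. \<forall>y\<in>U. \<forall>z\<in>U. le x y \<and> le y z \<longrightarrow> le x z)"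

definition Lset :: "'a set \<Rightarrow> ('a \<Rightarrow> 'a \<Rightarrow> bool) \<Rightarrow> 'a \<Rightarrow> 'a set" where
  "Lset U le u = {v \<in> U. le v u}"

definition Gset :: "'a set \<Rightarrow> ('a \<Rightarrow> 'a \<Rightarrow> bool) \<Rightarrow> 'a \<Rightarrow> 'a set" where
  "Gset U le u = {v \<in> U. le u v}"

definition Lstar :: "'a set \<Rightarrow> ('a \<Rightarrow> 'a \<Rightarrow> bool) \<Rightarrow> 'a \<Rightarrow> 'a set" where
  "Lstar U le u = Lset U le u - {u}"

definition Gstar :: "'a set \<Rightarrow> ('a \<Rightarrow> 'a \<Rightarrow> bool) \<Rightarrow> 'a \<Rightarrow> 'a set" where
  "Gstar U le u = Gset U le u - {u}"

text \<open>A (finite, nonempty) chain in S; a chain with k+1 elements has length k.\<close>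
definition is_chain :: "'a set \<Rightarrow> ('a \<Rightarrow> 'a \<Rightarrow> bool) \<Rightarrow> 'a set \<Rightarrow> bool" where
  "is_chain S le C \<longleftrightarrow> C \<subseteq> S \<and> finite C \<and> C \<noteq> {} \<and> (\<forall>x\<in>C. \<forall>y\<in>C. le x y \<or> le y x)"

definition dimension :: "'a set \<Rightarrow> ('a \<Rightarrow> 'a \<Rightarrow> bool) \<Rightarrow> enat" where
  "dimension S le = Sup {enat (card C - 1) | C. is_chain S le C}"

definition height :: "'a set \<Rightarrow> ('a \<Rightarrow> 'a \<Rightarrow> bool) \<Rightarrow> 'a \<Rightarrow> enat" where
  "height U le u = dimension (Lset U le u) le"

definition Hlev :: "'a set \<Rightarrow> ('a \<Rightarrow> 'a \<Rightarrow> bool) \<Rightarrow> nat \<Rightarrow> 'a set" where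
  "Hlev U le i = {u \<in> U. height U le u = enat i}"

definition minset :: "'a set \<Rightarrow> ('a \<Rightarrow> 'a \<Rightarrow> bool) \<Rightarrow> 'a set" where
  "minset U le = {u \<in> U. \<forall>v\<in>U. le v u \<longrightarrow> v = u}"

definition maxset :: "'a set \<Rightarrow> ('a \<Rightarrow> 'a \<Rightarrow> bool) \<Rightarrow> 'a set" where
  "maxset U le = {u \<in> U. \<forall>v\<in>U. le u v \<longrightarrow> v = u}"

definition mub :: "'a set \<Rightarrow> ('a \<Rightarrow> 'a \<Rightarrow> bool) \<Rightarrow> 'a set \<Rightarrow> 'a set" where
  "mub U le A = {u \<in> U. (\<forall>a\<in>A. le a u) \<and>
                  (\<forall>w\<in>U. (\<forall>a\<in>A. le a w) \<and> le w u \<longrightarrow> w = u)}"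

definition between :: "'a set \<Rightarrow> ('a \<Rightarrow> 'a \<Rightarrow> bool) \<Rightarrow> 'a \<Rightarrow> 'a \<Rightarrow> 'a set" where
  "between U le b c = {u \<in> U. Gstar U le u = {b} \<and> Lstar U le u = {c}}"

definition K_poset :: "'a set \<Rightarrow> ('a \<Rightarrow> 'a \<Rightarrow> bool) \<Rightarrow> bool" where
  "K_poset U le \<longleftrightarrow> poset U le \<and> dimension U le \<le> 2 \<and>
     finite (minset U le) \<and> finite (Hlev U le 2) \<and>
     (\<forall>u\<in>minset U le. \<forall>v\<in>minset U le. u \<noteq> v \<longrightarrow> finite (mub U le {u, v})) \<and>
     (\<forall>u\<in>U. \<forall>v\<in>U. \<forall>w\<in>U. le v u \<and> v \<noteq> u \<and> le w v \<and> w \<noteq> v \<longrightarrow>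
         infinite (between U le u w))"

definition proper_K_poset :: "'a set \<Rightarrow> ('a \<Rightarrow> 'a \<Rightarrow> bool) \<Rightarrow> bool" where
  "proper_K_poset U le \<longleftrightarrow> K_poset U le \<and>
     (\<forall>u\<in>maxset U le. \<forall>w\<in>minset U le. between U le u w = {} \<or> between U le u w \<approx> U)"

definition HH :: "'a set \<Rightarrow> ('a \<Rightarrow> 'a \<Rightarrow> bool) \<Rightarrow> 'a set" where
  "HH U le = minset U le \<union>
     {u \<in> Hlev U le 1. \<exists>a\<in>minset U le. \<exists>b\<in>minset U le. a \<noteq> b \<and> le a u \<and> le b u}"

definition Lambda :: "'a set \<Rightarrow> ('a \<Rightarrow> 'a \<Rightarrow> bool) \<Rightarrow> 'a \<Rightarrow> 'a set" where
  "Lambda W le n = (let Hs = HH W le - {n} in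
     (Hlev W le 1 \<inter> Hs) \<union> {v \<in> Hs. Gset W le v \<inter> Hlev W le 1 \<inter> Hs = {}})"

definition dval :: "'a set \<Rightarrow> ('a \<Rightarrow> 'a \<Rightarrow> bool) \<Rightarrow> 'a \<Rightarrow> nat" where
  "dval W le n = card (Lambda W le n)"

definition simple_poset :: "'a set \<Rightarrow> ('a \<Rightarrow> 'a \<Rightarrow> bool) \<Rightarrow> bool" where
  "simple_poset V le \<longleftrightarrow> proper_K_poset V le \<and>
     (\<forall>m\<in>maxset V le. height V le m > 0 \<longrightarrow> dval (Lset V le m) le m = 1)"

definition splitting :: "'b set \<Rightarrow> ('b \<Rightarrow> 'b \<Rightarrow> bool) \<Rightarrow> 'a set \<Rightarrow> ('a \<Rightarrow> 'a \<Rightarrow> bool) \<Rightarrow> 'a \<Rightarrow> bool" where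
  "splitting U leU V leV m \<longleftrightarrow>
     poset U leU \<and> poset V leV \<and> m \<in> maxset V leV \<and> height V leV m > 0 \<and>
     (\<exists>M \<phi>. finite M \<and> M \<noteq> {} \<and> M \<subseteq> maxset U leU \<and> (\<forall>x\<in>M. height U leU x > 0) \<and>
        \<phi> ` U = V \<and>
        (\<forall>x\<in>U. \<forall>y\<in>U. leU x y \<longrightarrow> leV (\<phi> x) (\<phi> y)) \<and>
        {x \<in> U. \<phi> x = m} = M \<and>
        (\<forall>v\<in>V. v \<noteq> m \<longrightarrow> card {x \<in> U. \<phi> x = v} = 1) \<and>
        (\<forall>x'\<in>U. \<forall>y\<in>V. leV (\<phi> x') y \<longrightarrow> (\<exists>y'\<in>U. leU x' y' \<and> \<phi> y' = y)))"

end

theory Submission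
  imports Defs
begin

text \<open>
  Let \<open>m\<close> be a maximal node of positive height with \<open>d(m) \<noteq> 1\<close>. There are only finitely many of
  these: such a node has height two or is a minimal common upper bound of two minimal nodes. For the
  latter reason \<open>\<Lambda>\<close> of \<open>L(m)\<close> is finite. Replace \<open>m\<close> by one node \<open>m\<^sub>\<lambda>\<close> for each \<open>\<lambda> \<in> \<Lambda>\<close>, put \<open>L(\<lambda>)\<close>
  below \<open>m\<^sub>\<lambda>\<close>, and distribute the remaining nodes below \<open>m\<close>. Each of these has height one and covers a
  single minimal node \<open>w\<close>; it may go below any \<open>m\<^sub>\<lambda>\<close> with \<open>w \<le> \<lambda>\<close>. If \<open>[m/w]\<close> is nonempty, then it
  is infinite of the size of the whole poset, so it can be partitioned into finitely many parts of
  that size, one for each \<open>\<lambda> \<ge> w\<close>. This keeps the poset a proper \<open>K\<close>-poset, each \<open>m\<^sub>\<lambda>\<close> has \<open>d = 1\<close>, and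
  the value of \<open>d\<close> at the other maximal nodes does not change. Hence the number of maximal nodes
  violating simplicity drops with each splitting.
\<close>

subsection \<open>Heights\<close>

text \<open>In a poset this says that some chain of length \<open>k\<close> has top
  \<open>u\<close>. Induction applies to it directly, without suprema in
  \<open>enat\<close>.\<close>

primrec ht_ge :: "'a set \<Rightarrow> ('a \<Rightarrow> 'a \<Rightarrow> bool) \<Rightarrow> nat \<Rightarrow> 'a \<Rightarrow> bool" where
  "ht_ge V le 0 u \<longleftrightarrow> u \<in> V"
| "ht_ge V le (Suc k) u \<longleftrightarrow> u \<in> V \<and> (\<exists>v. le v u \<and> v \<noteq> u \<and> ht_ge V le k v)"

lemma poset_refl: "poset V le \<Longrightarrow> x \<in> V \<Longrightarrow> le x x"
  by (simp add: poset_def)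

lemma poset_antisym: "poset V le \<Longrightarrow> x \<in> V \<Longrightarrow> y \<in> V \<Longrightarrow> le x y \<Longrightarrow> le y x \<Longrightarrow> x = y"
  unfolding poset_def by blast

lemma poset_trans:
  "poset V le \<Longrightarrow> x \<in> V \<Longrightarrow> y \<in> V \<Longrightarrow> z \<in> V \<Longrightarrow> le x y \<Longrightarrow> le y z \<Longrightarrow> le x z"
  unfolding poset_def by blast

lemma poset_subset: "poset V le \<Longrightarrow> W \<subseteq> V \<Longrightarrow> poset W le"
  unfolding poset_def by blast

lemma ht_ge_mem: "ht_ge V le k u \<Longrightarrow> u \<in> V"
  by (cases k) auto

lemma ht_ge_SucD: "ht_ge V le (Suc k) u \<Longrightarrow> ht_ge V le k u"
proof (induction k arbitrary: u)
  case (Suc k)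
  then obtain v where "u \<in> V" "le v u" "v \<noteq> u" "ht_ge V le (Suc k) v" by auto
  with Suc.IH[of v] show ?case by auto
qed simp

lemma ht_ge_antimono: "ht_ge V le k u \<Longrightarrow> j \<le> k \<Longrightarrow> ht_ge V le j u"
  by (induction k) (auto simp: le_Suc_eq dest: ht_ge_SucD simp del: ht_ge.simps(2))

lemma ht_ge_upward:
  assumes "poset V le" "ht_ge V le k v" "le v u" "u \<in> V"
  shows "ht_ge V le k u"
proof (cases k)
  case (Suc j)
  show ?thesis
  proof (cases "v = u")
    case False
    then show ?thesis using assms ht_ge_SucD[of V le j v] unfolding Suc by auto
  qed (use assms in simp)
qed (use assms in simp)

text \<open>By transitivity, a chain lies in \<open>Lset V le u\<close> as soon as its top
  \<open>v\<close> does.\<close>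

lemma ht_ge_Lset:
  assumes "poset V le" "u \<in> V"
  shows "ht_ge (Lset V le u) le k v \<longleftrightarrow> le v u \<and> ht_ge V le k v"
proof (induction k arbitrary: v)
  case (Suc k)
  have "le w u" if "le v u" "le w v" "ht_ge V le k w" "v \<in> V" for w
    using that assms ht_ge_mem[of V le k w] by (blast intro: poset_trans)
  with Suc show ?case by (auto simp: Lset_def)
qed (auto simp: Lset_def)

lemma finite_chain_greatest:
  assumes "finite C" "C \<noteq> {}" "poset V le" "C \<subseteq> V" "\<forall>x\<in>C. \<forall>y\<in>C. le x y \<or> le y x"
  shows "\<exists>u\<in>C. \<forall>x\<in>C. le x u"
  using assms
proof (induction C rule: finite_ne_induct)
  case (insert x F)
  then obtain u where u: "u \<in> F" "\<forall>y\<in>F. le y u" by auto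
  show ?case
  proof (cases "le x u")
    case False
    with insert.prems u have "le u x" by auto
    then have "\<forall>y\<in>insert x F. le y x"
      using u insert.prems by (auto intro: poset_trans[of V le _ u] poset_refl[of V le])
    then show ?thesis by blast
  qed (use u in blast)
qed auto

text \<open>The induction removes the greatest element; the rest is a chain with one element
  less.\<close>

lemma chain_imp_ht_ge:
  assumes "poset V le" "is_chain V le C" "card C = Suc k"
  shows "\<exists>u\<in>C. (\<forall>x\<in>C. le x u) \<and> ht_ge V le k u"
  using assms
proof (induction k arbitrary: C)
  case 0
  then obtain u where "C = {u}" by (auto simp: card_Suc_eq)
  with 0 show ?case by (auto simp: is_chain_def)
next
  case (Suc k)
  then obtain u where u: "u \<in> C" "\<forall>x\<in>C. le x u"
    using finite_chain_greatest[of C V le] by (auto simp: is_chain_def)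
  have card: "card (C - {u}) = Suc k" using Suc.prems u by (auto simp: is_chain_def)
  then have "C - {u} \<noteq> {}" by force
  then have "is_chain V le (C - {u})" using Suc.prems by (auto simp: is_chain_def)
  with Suc.IH[OF Suc.prems(1) _ card] obtain v where "v \<in> C - {u}" "ht_ge V le k v" by blast
  then have "ht_ge V le (Suc k) u" using u Suc.prems by (auto simp: is_chain_def)
  with u show ?case by blast
qed

lemma ht_ge_imp_chain:
  assumes "poset V le" "ht_ge V le k u"
  shows "\<exists>C. is_chain V le C \<and> card C = Suc k \<and> (\<forall>x\<in>C. le x u)"
  using assms(2)
proof (induction k arbitrary: u)
  case 0
  then show ?case
    by (intro exI[of _ "{u}"]) (auto simp: is_chain_def intro: poset_refl[OF assms(1)])
next
  case (Suc k)
  then obtain v where v: "u \<in> V" "le v u" "v \<noteq> u" "ht_ge V le k v" by auto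
  with Suc.IH obtain C where C: "is_chain V le C" "card C = Suc k" "\<forall>x\<in>C. le x v" by blast
  have "v \<in> V" using v ht_ge_mem by metis
  have CV: "C \<subseteq> V" "finite C" using C by (auto simp: is_chain_def)
  have le: "\<forall>x\<in>C. le x u"
    using C(3) v CV \<open>v \<in> V\<close> by (blast intro: poset_trans[OF assms(1), of _ v])
  have "u \<notin> C" using C(3) v \<open>v \<in> V\<close> poset_antisym[OF assms(1), of u v] by blast
  then have "is_chain V le (insert u C) \<and> card (insert u C) = Suc (Suc k) \<and> (\<forall>x\<in>insert u C. le x u)"
    using C CV le v(1) poset_refl[OF assms(1), of u] by (auto simp: is_chain_def)
  then show ?case by blast
qed

text \<open>A strict lower bound for a supremum is an existence statement, so it does not matter
  whether the supremum is attained. A chain that is too long is cut down by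
  \<open>ht_ge_antimono\<close>.\<close>

lemma less_dimension_iff:
  assumes "poset V le"
  shows "enat k < dimension V le \<longleftrightarrow> (\<exists>u. ht_ge V le (Suc k) u)"
proof -
  have "enat k < dimension V le \<longleftrightarrow> (\<exists>C. is_chain V le C \<and> k < card C - 1)"
    unfolding dimension_def by (auto simp: less_Sup_iff)
  also have "\<dots> \<longleftrightarrow> (\<exists>u. ht_ge V le (Suc k) u)"
  proof
    assume "\<exists>C. is_chain V le C \<and> k < card C - 1"
    then obtain C where C: "is_chain V le C" "k < card C - 1" by blast
    then have "card C = Suc (card C - 1)" by simp
    with chain_imp_ht_ge[OF assms C(1)] obtain u where "ht_ge V le (card C - 1) u" by blast
    with C(2) show "\<exists>u. ht_ge V le (Suc k) u" using ht_ge_antimono by (metis Suc_leI)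
  next
    assume "\<exists>u. ht_ge V le (Suc k) u"
    then obtain u where "ht_ge V le (Suc k) u" by blast
    from ht_ge_imp_chain[OF assms this] show "\<exists>C. is_chain V le C \<and> k < card C - 1"
      by (metis diff_Suc_1 lessI)
  qed
  finally show ?thesis .
qed

lemma less_height_iff:
  assumes "poset V le" "u \<in> V"
  shows "enat k < height V le u \<longleftrightarrow> ht_ge V le (Suc k) u"
proof -
  have "poset (Lset V le u) le" using assms(1) by (rule poset_subset) (auto simp: Lset_def)
  then show ?thesis
    unfolding height_def using assms
    by (simp add: less_dimension_iff ht_ge_Lset del: ht_ge.simps(2))
      (blast intro: ht_ge_upward poset_refl)
qed

lemma enat_eq_iff_less: "x = enat (Suc k) \<longleftrightarrow> enat k < x \<and> \<not> enat (Suc k) < x"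
  by (cases x) auto

lemma ht_ge_Suc_0: "u \<in> V \<Longrightarrow> ht_ge V le (Suc 0) u \<longleftrightarrow> u \<notin> minset V le"
  by (auto simp: minset_def)

lemma height_pos_iff:
  "poset V le \<Longrightarrow> u \<in> V \<Longrightarrow> 0 < height V le u \<longleftrightarrow> u \<notin> minset V le"
  using less_height_iff[of V le u 0] ht_ge_Suc_0[of u V le] by (simp add: enat_0)

lemma Hlev_Suc:
  "poset V le \<Longrightarrow> Hlev V le (Suc k) = {u \<in> V. ht_ge V le (Suc k) u \<and> \<not> ht_ge V le (Suc (Suc k)) u}"
  unfolding Hlev_def enat_eq_iff_less by (auto simp: less_height_iff simp del: ht_ge.simps(2))

lemma dimension_le_2_iff: "poset V le \<Longrightarrow> dimension V le \<le> 2 \<longleftrightarrow> (\<forall>u. \<not> ht_ge V le 3 u)"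
  using less_dimension_iff[of V le 2] by (auto simp: numeral_eq_enat numeral_3_eq_3 numeral_2_eq_2 not_less[symmetric])

text \<open>Once \<open>ht_ge U le 3\<close> is excluded, height exactly two is the same as
  \<open>ht_ge U le 2\<close>. This removes \<open>enat\<close> from the axioms.\<close>

lemma K_poset_iff:
  "K_poset U le \<longleftrightarrow> poset U le \<and> (\<forall>u. \<not> ht_ge U le 3 u) \<and>
     finite (minset U le) \<and> finite {u. ht_ge U le 2 u} \<and>
     (\<forall>u\<in>minset U le. \<forall>v\<in>minset U le. u \<noteq> v \<longrightarrow> finite (mub U le {u, v})) \<and>
     (\<forall>u\<in>U. \<forall>v\<in>U. \<forall>w\<in>U. le v u \<and> v \<noteq> u \<and> le w v \<and> w \<noteq> v \<longrightarrow>
         infinite (between U le u w))"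
proof -
  have "Hlev U le 2 = {u. ht_ge U le 2 u}"
    if "poset U le" "\<forall>u. \<not> ht_ge U le 3 u"
    using Hlev_Suc[OF that(1), of 1] that(2) ht_ge_mem[of U le 2]
    by (auto simp: numeral_2_eq_2 numeral_3_eq_3 simp del: ht_ge.simps(2))
  then show ?thesis
    unfolding K_poset_def using dimension_le_2_iff[of U le] by auto
qed

subsection \<open>The set \<open>\<Lambda>\<close>\<close>

text \<open>For nodes of height one this is membership in \<open>HH\<close>. The height is left out
  because it is automatic strictly below a node of a K-poset: such nodes fail
  \<open>ht_ge V le 2\<close> by \<open>Lstar_not_ht2\<close>, and \<open>two_min\<close> excludes
  minimal ones.\<close>

definition two_min :: "'a set \<Rightarrow> ('a \<Rightarrow> 'a \<Rightarrow> bool) \<Rightarrow> 'a \<Rightarrow> bool" where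
  "two_min V le u \<longleftrightarrow> (\<exists>a\<in>minset V le. \<exists>b\<in>minset V le. a \<noteq> b \<and> le a u \<and> le b u)"

text \<open>
  \<open>lam V le (Lstar V le m)\<close> is \<open>\<Lambda>\<close> of the poset \<open>L(m)\<close>, see \<open>Lambda_Lset_eq_lam\<close>. The argument is the
  strict lower set rather than \<open>m\<close> because a splitting replaces it by smaller ones.
\<close>

definition lam :: "'a set \<Rightarrow> ('a \<Rightarrow> 'a \<Rightarrow> bool) \<Rightarrow> 'a set \<Rightarrow> 'a set" where
  "lam V le D = {u \<in> D. two_min V le u} \<union>
     {v \<in> D \<inter> minset V le. \<forall>u\<in>D. two_min V le u \<longrightarrow> \<not> le v u}"

text \<open>The obstructions to simplicity, by \<open>simple_poset_iff\<close>. Their number is the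
  induction measure.\<close>

definition bad_set :: "'a set \<Rightarrow> ('a \<Rightarrow> 'a \<Rightarrow> bool) \<Rightarrow> 'a set" where
  "bad_set V le = {m \<in> maxset V le - minset V le. card (lam V le (Lstar V le m)) \<noteq> 1}"

lemma Lstar_iff: "x \<in> Lstar V le u \<longleftrightarrow> x \<in> V \<and> le x u \<and> x \<noteq> u"
  by (auto simp: Lstar_def Lset_def)

lemma Gstar_iff: "x \<in> Gstar V le u \<longleftrightarrow> x \<in> V \<and> le u x \<and> x \<noteq> u"
  by (auto simp: Gstar_def Gset_def)

lemma minset_iff: "u \<in> minset V le \<longleftrightarrow> u \<in> V \<and> Lstar V le u = {}"
  by (auto simp: minset_def Lstar_def Lset_def)

lemma maxset_iff: "u \<in> maxset V le \<longleftrightarrow> u \<in> V \<and> Gstar V le u = {}"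
  by (auto simp: maxset_def Gstar_def Gset_def)

lemma two_min_not_min: "two_min V le u \<Longrightarrow> u \<notin> minset V le"
  by (auto simp: two_min_def minset_def)

lemma ht_ge_2_iff:
  "ht_ge V le 2 u \<longleftrightarrow> u \<in> V \<and> (\<exists>v\<in>Lstar V le u. v \<notin> minset V le)"
  by (auto simp: numeral_2_eq_2 Lstar_iff minset_def)

section \<open>Chains, minimal nodes and finiteness in a K-poset\<close>

lemma
  assumes "K_poset V le"
  shows K_poset_poset: "poset V le"
    and K_poset_no_ht3: "\<not> ht_ge V le 3 u"
    and K_poset_finite_minset: "finite (minset V le)"
    and K_poset_finite_ht2: "finite {u. ht_ge V le 2 u}"
  using assms by (auto simp: K_poset_iff)

text \<open>Otherwise a node strictly below \<open>w\<close> would extend \<open>w < v < u\<close>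
  to a chain of length three.\<close>

lemma K_poset_chain3_minset:
  assumes "K_poset V le" "u \<in> V" "v \<in> Lstar V le u" "w \<in> Lstar V le v"
  shows "w \<in> minset V le"
proof (rule ccontr)
  assume "w \<notin> minset V le"
  with assms have "ht_ge V le 3 u"
    by (auto simp: numeral_3_eq_3 minset_def Lstar_iff)
  then show False using K_poset_no_ht3[OF assms(1)] by blast
qed

text \<open>At most two strict steps down reach a minimal node, by
  \<open>K_poset_chain3_minset\<close>.\<close>

lemma K_poset_minimal_below:
  assumes "K_poset V le" "u \<in> V"
  shows "\<exists>w\<in>minset V le. le w u"
proof (cases "u \<in> minset V le")
  case True
  then show ?thesis using poset_refl[OF K_poset_poset[OF assms(1)]] assms(2) by blast
next
  case False
  then obtain v where v: "v \<in> Lstar V le u" using assms(2) by (auto simp: minset_iff)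
  show ?thesis
  proof (cases "v \<in> minset V le")
    case False
    then obtain w where w: "w \<in> Lstar V le v"
      using v minset_iff[of v V le] Lstar_iff[of v V le u] by blast
    have "le w u"
      using poset_trans[OF K_poset_poset[OF assms(1)], of w v u] v w assms(2) by (auto simp: Lstar_iff)
    then show ?thesis using K_poset_chain3_minset[OF assms v w] by blast
  qed (use v in \<open>auto simp: Lstar_iff\<close>)
qed

text \<open>Everything strictly below such a \<open>u\<close> is minimal, so \<open>u\<close> is a
  minimal common upper bound of any two distinct minimal nodes below it. There are finitely many
  pairs, each with a finite \<open>mub\<close>.\<close>

lemma finite_two_min_ht1:
  assumes K: "K_poset V le"
  shows "finite {u \<in> V. two_min V le u \<and> \<not> ht_ge V le 2 u}" (is "finite ?A")
proof -
  let ?M = "minset V le"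
  have "?A \<subseteq> (\<Union>a\<in>?M. \<Union>b\<in>?M - {a}. mub V le {a, b})"
  proof
    fix u assume u: "u \<in> ?A"
    then obtain a b where ab: "a \<in> ?M" "b \<in> ?M" "a \<noteq> b" "le a u" "le b u"
      by (auto simp: two_min_def)
    have "w = u" if "w \<in> V" "le a w" "le b w" "le w u" for w
    proof (rule ccontr)
      assume "w \<noteq> u"
      with that u have "w \<in> ?M" by (auto simp: ht_ge_2_iff Lstar_iff)
      with ab that have "a = w" "b = w" by (auto simp: minset_def)
      with ab show False by simp
    qed
    with u ab have "u \<in> mub V le {a, b}" by (auto simp: mub_def)
    with ab show "u \<in> (\<Union>a\<in>?M. \<Union>b\<in>?M - {a}. mub V le {a, b})" by blast
  qed
  moreover have "finite (\<Union>a\<in>?M. \<Union>b\<in>?M - {a}. mub V le {a, b})"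
    using K by (auto simp: K_poset_iff)
  ultimately show ?thesis by (rule finite_subset)
qed

lemma Lstar_not_ht2:
  assumes "K_poset V le" "m \<in> V" "u \<in> Lstar V le m"
  shows "\<not> ht_ge V le 2 u"
  using K_poset_chain3_minset[OF assms] by (auto simp: ht_ge_2_iff)

lemma finite_lam:
  assumes "K_poset V le" "m \<in> V"
  shows "finite (lam V le (Lstar V le m))"
proof -
  have "lam V le (Lstar V le m) \<subseteq>
      {u \<in> V. two_min V le u \<and> \<not> ht_ge V le 2 u} \<union> minset V le"
    using Lstar_not_ht2[OF assms] by (auto simp: lam_def Lstar_iff)
  then show ?thesis
    by (rule finite_subset)
      (use finite_two_min_ht1[OF assms(1)] K_poset_finite_minset[OF assms(1)] in simp)
qed

text \<open>Either some \<open>two_min\<close> node above \<open>w\<close> is a member, or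
  \<open>w\<close> itself is one. In the construction this gives every node over \<open>w\<close> a
  new maximal node to go under.\<close>

lemma lam_above_minimal:
  assumes "K_poset V le" "w \<in> minset V le" "w \<in> Lstar V le m"
  shows "\<exists>v\<in>lam V le (Lstar V le m). le w v"
proof (cases "\<exists>u\<in>Lstar V le m. two_min V le u \<and> le w u")
  case False
  then have "w \<in> lam V le (Lstar V le m)" using assms by (auto simp: lam_def)
  then show ?thesis
    using assms poset_refl[OF K_poset_poset[OF assms(1)], of w] by (auto simp: Lstar_iff)
qed (auto simp: lam_def)

lemma lam_nonempty:
  assumes "K_poset V le" "m \<in> V" "m \<notin> minset V le"
  shows "lam V le (Lstar V le m) \<noteq> {}"
proof -
  obtain w where "w \<in> minset V le" "le w m" using K_poset_minimal_below[OF assms(1,2)] by blast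
  then show ?thesis
    using lam_above_minimal[OF assms(1), of w m] assms(3) by (cases "w = m") (auto simp: Lstar_iff minset_def)
qed

lemma finite_bad_set:
  assumes K: "K_poset V le"
  shows "finite (bad_set V le)"
proof -
  have "bad_set V le \<subseteq> {u. ht_ge V le 2 u} \<union> {u \<in> V. two_min V le u \<and> \<not> ht_ge V le 2 u}"
  proof
    fix m assume m: "m \<in> bad_set V le"
    then have mV: "m \<in> V" "m \<notin> minset V le" and c: "card (lam V le (Lstar V le m)) \<noteq> 1"
      by (auto simp: bad_set_def maxset_def)
    \<comment> \<open>All nodes strictly below \<open>m\<close> are then minimal, hence so is all of
      \<open>lam\<close>. Being nonempty and not a singleton, it contains two of them.\<close>
    have "two_min V le m" if "\<not> ht_ge V le 2 m"
    proof -
      have "Lstar V le m \<subseteq> minset V le" using that mV by (auto simp: ht_ge_2_iff)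
      then have L: "lam V le (Lstar V le m) \<subseteq> minset V le \<inter> Lstar V le m"
        by (auto simp: lam_def)
      have "\<not> is_singleton (lam V le (Lstar V le m))" using c by (simp add: is_singleton_altdef)
      with lam_nonempty[OF K mV] obtain a b
        where "a \<in> lam V le (Lstar V le m)" "b \<in> lam V le (Lstar V le m)" "a \<noteq> b"
        by (metis is_singletonI')
      with L have "a \<in> minset V le" "b \<in> minset V le" "le a m" "le b m" "a \<noteq> b"
        by (auto simp: Lstar_iff)
      then show ?thesis unfolding two_min_def by blast
    qed
    with mV show "m \<in> {u. ht_ge V le 2 u} \<union> {u \<in> V. two_min V le u \<and> \<not> ht_ge V le 2 u}"
      by blast
  qed
  then show ?thesis
    by (rule finite_subset) (use finite_two_min_ht1[OF K] K_poset_finite_ht2[OF K] in simp)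
qed

text \<open>\<open>L(m)\<close> is downward closed, so minimal nodes and \<open>two_min\<close> mean
  the same there as in \<open>V\<close>. Non-minimal nodes strictly below \<open>m\<close> have
  height one.\<close>

lemma Lambda_Lset_eq_lam:
  assumes K: "K_poset V le" and m: "m \<in> V"
  shows "Lambda (Lset V le m) le m = lam V le (Lstar V le m)"
proof -
  let ?W = "Lset V le m" and ?L = "Lstar V le m"
  note P = K_poset_poset[OF K]
  have WV: "?W \<subseteq> V" by (auto simp: Lset_def)
  have PW: "poset ?W le" using P WV by (rule poset_subset)
  have trans: "le x m" if "le x y" "y \<in> ?W" "x \<in> V" for x y
    using that m poset_trans[OF P, of x y m] by (auto simp: Lset_def)
  have min: "minset ?W le = minset V le \<inter> ?W"
    using trans by (auto simp: minset_def Lset_def)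
  have tm: "two_min ?W le u \<longleftrightarrow> two_min V le u" if "u \<in> ?W" for u
    unfolding two_min_def min using trans[OF _ that] by (auto simp: Lset_def minset_def)
  have lev: "Hlev ?W le 1 \<inter> (HH ?W le - {m}) = {u \<in> ?L. two_min V le u}" (is "?A = ?B")
  proof (intro equalityI subsetI)
    fix u assume u: "u \<in> ?A"
    then have "u \<in> ?W" "u \<noteq> m" "u \<notin> minset ?W le"
      using Hlev_Suc[OF PW, of 0] by (auto simp: minset_def)
    with u have "two_min ?W le u" by (auto simp: HH_def two_min_def)
    with \<open>u \<in> ?W\<close> \<open>u \<noteq> m\<close> tm show "u \<in> ?B" by (auto simp: Lstar_def)
  next
    fix u assume u: "u \<in> ?B"
    then have uW: "u \<in> ?W" "u \<noteq> m" "two_min ?W le u" using tm by (auto simp: Lstar_def)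
    have "\<not> ht_ge V le 2 u" using Lstar_not_ht2[OF K m] u by blast
    then have "\<not> ht_ge ?W le (Suc 1) u" using ht_ge_Lset[OF P m] by (simp only: numeral_2_eq_2 One_nat_def) simp
    moreover have "u \<notin> minset ?W le" using two_min_not_min uW(3) by fast
    then have "ht_ge ?W le (Suc 0) u" using ht_ge_Suc_0[OF uW(1)] by blast
    ultimately have "u \<in> Hlev ?W le 1"
      using Hlev_Suc[OF PW, of 0] uW by (simp del: ht_ge.simps(2))
    with uW show "u \<in> ?A" by (auto simp: HH_def two_min_def)
  qed
  have rest: "{v \<in> HH ?W le - {m}. Gset ?W le v \<inter> Hlev ?W le 1 \<inter> (HH ?W le - {m}) = {}}
      = {v \<in> ?L \<inter> minset V le. \<forall>u\<in>?L. two_min V le u \<longrightarrow> \<not> le v u}" (is "?C = ?D")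
  proof -
    have C: "v \<in> ?C \<longleftrightarrow> v \<in> HH ?W le - {m} \<and> (\<forall>u\<in>?L. two_min V le u \<longrightarrow> \<not> le v u)" for v
      using lev by (auto simp: Gset_def Lstar_def)
    \<comment> \<open>A non-minimal \<open>v\<close> in \<open>HH\<close> has height one and thus
      lies in the first part of \<open>Lambda\<close>. Since \<open>v\<close> belongs to
      \<open>G(v)\<close>, it cannot lie in the second.\<close>
    have "v \<in> minset V le" if "v \<in> ?C" for v
    proof (rule ccontr)
      assume nm: "v \<notin> minset V le"
      have v: "v \<in> HH ?W le" "v \<noteq> m" using that by auto
      with nm min have "v \<in> Hlev ?W le 1" by (auto simp: HH_def)
      with v lev have "v \<in> ?L" "two_min V le v" by auto
      with that C poset_refl[OF P, of v] show False by (auto simp: Lstar_iff)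
    qed
    moreover have "v \<in> HH ?W le - {m} \<longleftrightarrow> v \<in> ?L" if "v \<in> minset V le" for v
    proof -
      have "v \<in> minset ?W le \<longleftrightarrow> v \<in> ?W" using that min by blast
      then show ?thesis by (auto simp: HH_def Lstar_def minset_def Hlev_def)
    qed
    ultimately show ?thesis using C by blast
  qed
  show ?thesis unfolding Lambda_def Let_def lev rest lam_def ..
qed

lemma simple_poset_iff:
  "simple_poset V le \<longleftrightarrow> proper_K_poset V le \<and> bad_set V le = {}"
proof (cases "K_poset V le")
  case True
  have "height V le m > 0 \<longleftrightarrow> m \<notin> minset V le"
    "dval (Lset V le m) le m = card (lam V le (Lstar V le m))" if "m \<in> maxset V le" for m
    using that height_pos_iff[OF K_poset_poset[OF True], of m] Lambda_Lset_eq_lam[OF True, of m]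
    by (simp_all add: maxset_def dval_def)
  then have "(\<forall>m\<in>maxset V le. height V le m > 0 \<longrightarrow> dval (Lset V le m) le m = 1)
      \<longleftrightarrow> bad_set V le = {}"
    unfolding bad_set_def by auto
  then show ?thesis by (simp add: simple_poset_def)
qed (auto simp: simple_poset_def proper_K_poset_def)

section \<open>Cardinal arithmetic\<close>

text \<open>For infinite \<open>X\<close> there is a bijection with \<open>X \<times> F\<close>, and
  the second component partitions \<open>X\<close>. The empty case is included because
  \<open>[m/w]\<close> may be empty. Outside \<open>X\<close> the function takes a default value, so
  that all its values lie in \<open>F\<close>.\<close>

lemma infinite_partition_eqpoll:
  assumes "infinite X \<or> X = {}" "finite F" "F \<noteq> {}"
  shows "\<exists>f. (\<forall>x. f x \<in> F) \<and> (\<forall>y\<in>F. {x\<in>X. f x = y} \<approx> X)"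
proof (cases "X = {}")
  case True
  then show ?thesis using assms(3) by (auto intro!: exI[of _ "\<lambda>_. SOME y. y \<in> F"] some_in_eq[THEN iffD2])
next
  case False
  with assms have inf: "infinite X" by blast
  have "ordLeq3 (card_of F) (card_of X)"
    using finite_lepoll_infinite[OF inf assms(2)] by (simp add: lepoll_def card_of_ordLeq)
  then have "X \<approx> X \<times> F"
    unfolding eqpoll_iff_card_of_ordIso using card_of_Times_infinite_simps(2)[OF inf assms(3)] by blast
  then obtain h where h: "bij_betw h X (X \<times> F)" by (auto simp: eqpoll_def)
  obtain y0 where "y0 \<in> F" using assms(3) by blast
  define f where "f x = (if x \<in> X then snd (h x) else y0)" for x
  have "f x \<in> F" for x
    using bij_betwE[OF h] \<open>y0 \<in> F\<close> by (auto simp: f_def mem_Times_iff)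
  moreover have "{x\<in>X. f x = y} \<approx> X" if "y \<in> F" for y
  proof -
    have "bij_betw h {x\<in>X. f x = y} (X \<times> {y})"
    proof (rule bij_betw_subset[OF h])
      have "p \<in> h ` {x\<in>X. f x = y}" if p: "p \<in> X \<times> {y}" for p
      proof -
        have "p \<in> h ` X" using h p \<open>y \<in> F\<close> by (auto simp: bij_betw_def)
        then obtain x where "x \<in> X" "p = h x" by blast
        with p have "x \<in> {x\<in>X. f x = y}" by (auto simp: f_def)
        with \<open>p = h x\<close> show ?thesis by blast
      qed
      moreover have "h x \<in> X \<times> F" if "x \<in> X" for x using h that by (auto simp: bij_betw_def)
      ultimately show "h ` {x\<in>X. f x = y} = X \<times> {y}" by (force simp: f_def)
    qed auto
    then have "{x\<in>X. f x = y} \<approx> X \<times> {y}" by (auto simp: eqpoll_def)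
    also have "\<dots> \<approx> {y} \<times> X" by (rule times_commute_eqpoll)
    also have "\<dots> \<approx> X" by (rule times_singleton_eqpoll)
    finally show ?thesis .
  qed
  ultimately show ?thesis by blast
qed

lemma infinite_Un_finite_eqpoll: "finite N \<Longrightarrow> infinite A \<Longrightarrow> N \<union> A \<approx> A"
proof (induction N rule: finite_induct)
  case (insert x F)
  then have "insert x (F \<union> A) \<approx> F \<union> A" by (intro infinite_insert_eqpoll) auto
  with insert show ?case using eqpoll_trans by force
qed simp

subsection \<open>Splitting along a family of lower sets\<close>

lemma between_iff:
  "x \<in> between V le b c \<longleftrightarrow> x \<in> V \<and> Gstar V le x = {b} \<and> Lstar V le x = {c}"
  by (simp add: between_def)

text \<open>
  The node \<open>m\<close> is replaced by the nodes in \<open>N\<close>; the image under \<open>\<phi>\<close> of the strict lower set of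
  \<open>y \<in> N\<close> is \<open>D y\<close>.
\<close>

locale lower_set_splitting =
  fixes V :: "'a set" and le :: "'a \<Rightarrow> 'a \<Rightarrow> bool" and m :: 'a
    and U :: "'b set" and \<phi> :: "'b \<Rightarrow> 'a" and D :: "'b \<Rightarrow> 'a set" and N :: "'b set"
  assumes proper: "proper_K_poset V le"
    and m_max: "m \<in> maxset V le" and m_not_min: "m \<notin> minset V le"
    and image: "\<phi> ` U = V"
    and inj: "inj_on \<phi> (U - N)"
    and N_eq: "N = {x \<in> U. \<phi> x = m}" and finite_N: "finite N"
    and D_below: "y \<in> N \<Longrightarrow> D y \<subseteq> Lstar V le m"
    and D_down: "y \<in> N \<Longrightarrow> v \<in> D y \<Longrightarrow> x \<in> V \<Longrightarrow> le x v \<Longrightarrow> x \<in> D y"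
    and D_nonempty: "y \<in> N \<Longrightarrow> D y \<noteq> {}"
    and D_cover: "x \<in> Lstar V le m \<Longrightarrow> \<exists>y\<in>N. x \<in> D y"
    and D_disjoint: "x \<in> between V le m w \<Longrightarrow> y \<in> N \<Longrightarrow> z \<in> N \<Longrightarrow> x \<in> D y \<Longrightarrow> x \<in> D z \<Longrightarrow> y = z"
    and D_large: "y \<in> N \<Longrightarrow> w \<in> minset V le \<Longrightarrow> v \<in> D y \<Longrightarrow> w \<in> Lstar V le v \<Longrightarrow>
                   between V le m w \<inter> D y \<approx> V"
    and D_lam: "y \<in> N \<Longrightarrow> card (lam V le (D y)) = 1"
begin

text \<open>The order of \<open>V\<close> is pulled back along \<open>\<phi>\<close>, except below a
  node \<open>y\<close> over \<open>m\<close>. There the disjunct \<open>x = y\<close> supplies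
  reflexivity, since \<open>m\<close> is not in \<open>D y\<close>, and distinct nodes over
  \<open>m\<close> stay incomparable.\<close>

definition R :: "'b \<Rightarrow> 'b \<Rightarrow> bool" where
  "R x y \<longleftrightarrow> (if \<phi> y = m then x = y \<or> \<phi> x \<in> D y else le (\<phi> x) (\<phi> y))"

section \<open>Elementary properties of \<open>\<phi>\<close> and \<open>R\<close>\<close>

lemma K: "K_poset V le"
  using proper by (simp add: proper_K_poset_def)

lemmas V_poset = K_poset_poset[OF K]
lemmas V_refl = poset_refl[OF V_poset]
lemmas V_antisym = poset_antisym[OF V_poset]
lemmas V_trans = poset_trans[OF V_poset]

lemma m_mem: "m \<in> V"
  using m_max by (simp add: maxset_def)

lemma le_m_eq: "le m v \<Longrightarrow> v \<in> V \<Longrightarrow> v = m"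
  using m_max by (auto simp: maxset_def)

lemma phi_mem: "x \<in> U \<Longrightarrow> \<phi> x \<in> V"
  using image by blast

lemma obtain_preimage: "v \<in> V \<Longrightarrow> \<exists>x\<in>U. \<phi> x = v"
  using image by blast

lemma D_mem: "y \<in> U \<Longrightarrow> \<phi> y = m \<Longrightarrow> v \<in> D y \<Longrightarrow> v \<in> V \<and> le v m \<and> v \<noteq> m"
  using D_below[of y] by (auto simp: N_eq Lstar_iff)

lemma phi_inj: "x \<in> U \<Longrightarrow> y \<in> U \<Longrightarrow> \<phi> x = \<phi> y \<Longrightarrow> \<phi> x \<noteq> m \<Longrightarrow> x = y"
  using inj by (auto simp: inj_on_def N_eq)

lemma R_le: "x \<in> U \<Longrightarrow> y \<in> U \<Longrightarrow> R x y \<Longrightarrow> le (\<phi> x) (\<phi> y)"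
  using D_mem[of y "\<phi> x"] V_refl[OF phi_mem] by (auto simp: R_def split: if_splits)

text \<open>Distinct nodes with the same image lie over \<open>m\<close>, and those are
  incomparable.\<close>

lemma R_strict: "x \<in> U \<Longrightarrow> y \<in> U \<Longrightarrow> R x y \<Longrightarrow> x \<noteq> y \<Longrightarrow> \<phi> x \<noteq> \<phi> y"
  using D_mem[of y "\<phi> x"] phi_inj[of x y] by (auto simp: R_def split: if_splits)

lemma U_poset: "poset U R"
  unfolding poset_def
proof (intro conjI ballI impI)
  show "R x x" if "x \<in> U" for x
    using that V_refl[OF phi_mem] by (simp add: R_def)
  show "x = y" if "x \<in> U" "y \<in> U" "R x y \<and> R y x" for x y
    using that R_le[of x y] R_le[of y x] R_strict[of x y] V_antisym[OF phi_mem phi_mem] by blast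
  show "R x z" if xyz: "x \<in> U" "y \<in> U" "z \<in> U" and R: "R x y \<and> R y z" for x y z
  proof (cases "y = z")
    case yz: False
    \<comment> \<open>If \<open>y\<close> lay over the maximal node \<open>m\<close>, then so would
      \<open>z\<close>, against \<open>R_strict\<close>.\<close>
    then have ym: "\<phi> y \<noteq> m"
      using R R_strict[of y z] R_le[of y z] le_m_eq[of "\<phi> z"] xyz phi_mem by metis
    have le: "le (\<phi> x) (\<phi> y)" using R R_le xyz by blast
    show ?thesis
    proof (cases "\<phi> z = m")
      case True
      then have "\<phi> y \<in> D z" using R yz by (simp add: R_def)
      then have "\<phi> x \<in> D z" using D_down[of z "\<phi> y" "\<phi> x"] le xyz True phi_mem by (simp add: N_eq)
      then show ?thesis using True by (simp add: R_def)
    next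
      case False
      then show ?thesis
        using le R R_le[of y z] V_trans[OF phi_mem phi_mem phi_mem, of x y z] xyz by (simp add: R_def)
    qed
  qed (use R in blast)
qed

text \<open>This is the lifting condition of a splitting. For \<open>v = m\<close> it rests on
  \<open>D_cover\<close>; below a node over any other \<open>v\<close> the order is the pulled back
  one.\<close>

lemma lift_up:
  assumes "x \<in> U" "v \<in> V" "le (\<phi> x) v"
  shows "\<exists>y\<in>U. R x y \<and> \<phi> y = v"
proof (cases "v = m")
  case True
  show ?thesis
  proof (cases "\<phi> x = m")
    case False
    then have "\<phi> x \<in> Lstar V le m" using assms phi_mem True by (simp add: Lstar_iff)
    then obtain y where "y \<in> N" "\<phi> x \<in> D y" using D_cover by blast
    then show ?thesis using True by (auto simp: R_def N_eq)
  qed (use assms True in \<open>auto simp: R_def\<close>)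
next
  case False
  then show ?thesis using assms obtain_preimage by (auto simp: R_def)
qed

section \<open>Strict lower and upper sets in \<open>U\<close>\<close>

text \<open>Nothing strictly below another node lies over \<open>m\<close>, and away from the fibre
  of \<open>m\<close> the map \<open>\<phi>\<close> is injective.\<close>

lemma phi_down_image:
  assumes "x \<in> U"
  shows "\<phi> ` Lstar U R x = (if \<phi> x = m then D x else Lstar V le (\<phi> x))"
    and "inj_on \<phi> (Lstar U R x)"
    and "y \<in> Lstar U R x \<Longrightarrow> \<phi> y \<noteq> m"
proof -
  show nm: "\<phi> y \<noteq> m" if "y \<in> Lstar U R x" for y
    using that assms R_strict[of y x] R_le[of y x] le_m_eq[of "\<phi> x"] phi_mem by (auto simp: Lstar_iff)
  then show "inj_on \<phi> (Lstar U R x)"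
    by (intro inj_onI) (simp add: Lstar_iff phi_inj)
  show "\<phi> ` Lstar U R x = (if \<phi> x = m then D x else Lstar V le (\<phi> x))" (is "?L = ?E")
  proof (intro equalityI subsetI)
    fix v assume "v \<in> ?L"
    then obtain y where y: "y \<in> Lstar U R x" "v = \<phi> y" by blast
    then show "v \<in> ?E"
      using assms R_strict[of y x] phi_mem by (auto simp: Lstar_iff R_def)
  next
    fix v assume v: "v \<in> ?E"
    then have vV: "v \<in> V" using D_mem[OF assms] by (auto simp: Lstar_iff split: if_splits)
    then obtain y where y: "y \<in> U" "v = \<phi> y" using obtain_preimage by blast
    have "R y x" using v y by (auto simp: R_def Lstar_iff split: if_splits)
    moreover have "y \<noteq> x" using v y D_mem[OF assms, of v] by (auto simp: Lstar_iff split: if_splits)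
    ultimately show "v \<in> ?L" using y by (auto simp: Lstar_iff)
  qed
qed

text \<open>Surjectivity is \<open>lift_up\<close>. Injectivity can fail on upper sets, as a node
  may lie below several nodes over \<open>m\<close>; for the members of \<open>between\<close> it is
  restored by \<open>D_disjoint\<close>.\<close>

lemma phi_up_image:
  assumes "x \<in> U"
  shows "\<phi> ` Gstar U R x = Gstar V le (\<phi> x)"
proof (intro equalityI subsetI)
  fix v assume "v \<in> \<phi> ` Gstar U R x"
  then show "v \<in> Gstar V le (\<phi> x)"
    using assms R_strict[of x] R_le[of x] phi_mem by (force simp: Gstar_iff)
next
  fix v assume "v \<in> Gstar V le (\<phi> x)"
  then show "v \<in> \<phi> ` Gstar U R x"
    using assms lift_up[of x v] by (force simp: Gstar_iff)
qed

text \<open>\<open>D_nonempty\<close> keeps the nodes over \<open>m\<close> from becoming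
  minimal.\<close>

lemma U_minset: "x \<in> U \<Longrightarrow> x \<in> minset U R \<longleftrightarrow> \<phi> x \<in> minset V le"
  using phi_down_image(1)[of x] m_not_min D_nonempty[of x] phi_mem[of x]
  unfolding minset_iff by (auto simp: N_eq split: if_splits)

lemma U_maxset: "x \<in> U \<Longrightarrow> x \<in> maxset U R \<longleftrightarrow> \<phi> x \<in> maxset V le"
  using phi_up_image[of x] phi_mem[of x] unfolding maxset_iff by auto

lemma ht_ge_phi: "ht_ge U R k x \<Longrightarrow> ht_ge V le k (\<phi> x)"
proof (induction k arbitrary: x)
  case (Suc k)
  then obtain y where "x \<in> U" "R y x" "y \<noteq> x" "ht_ge U R k y" by auto
  moreover from this have "y \<in> U" using ht_ge_mem by metis
  ultimately show ?case
    using Suc.IH[of y] R_le[of y x] R_strict[of y x] phi_mem[of x] by auto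
qed (use phi_mem in simp)

lemma finite_preimage:
  assumes "finite A"
  shows "finite {x \<in> U. \<phi> x \<in> A}"
proof -
  have "{x \<in> U. \<phi> x \<in> A} \<subseteq> N \<union> (\<phi> -` A \<inter> (U - N))" by blast
  then show ?thesis
    using finite_vimage_IntI[OF assms inj] finite_N by (auto intro: finite_subset)
qed

lemma preimage_eqpoll:
  assumes "A \<subseteq> V" "m \<notin> A"
  shows "{x \<in> U. \<phi> x \<in> A} \<approx> A"
proof -
  have "inj_on \<phi> {x \<in> U. \<phi> x \<in> A}" using phi_inj assms(2) by (auto simp: inj_on_def)
  moreover have "\<phi> ` {x \<in> U. \<phi> x \<in> A} = A" using obtain_preimage assms(1) by force
  ultimately show ?thesis unfolding eqpoll_def bij_betw_def by blast
qed

text \<open>Up to a bijection, \<open>U\<close> and \<open>V\<close> differ only in the finite fibre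
  \<open>N\<close> and the node \<open>m\<close>. So properness of \<open>U\<close> may be tested
  against the size of \<open>V\<close>.\<close>

lemma U_eqpoll_V:
  assumes "infinite V"
  shows "U \<approx> V"
proof -
  have V: "V = insert m (V - {m})" using m_mem by blast
  have inf: "infinite (V - {m})" using assms by simp
  have e: "{x \<in> U. \<phi> x \<in> V - {m}} \<approx> V - {m}" by (rule preimage_eqpoll) auto
  have "U = N \<union> {x \<in> U. \<phi> x \<in> V - {m}}" using phi_mem by (auto simp: N_eq)
  also have "\<dots> \<approx> {x \<in> U. \<phi> x \<in> V - {m}}"
    using infinite_Un_finite_eqpoll[OF finite_N] eqpoll_finite_iff[OF e] inf by blast
  also note e
  also have "V - {m} \<approx> V"
    using infinite_insert_eqpoll[OF inf, of m] V eqpoll_sym by metis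
  finally show ?thesis .
qed

section \<open>The sets \<open>between\<close> in \<open>U\<close>\<close>

text \<open>Members of \<open>between\<close> have a node strictly above them, unlike the maximal
  node \<open>m\<close>. So these sets stay where \<open>\<phi>\<close> is injective.\<close>

lemma between_m: "x \<in> between V le u w \<Longrightarrow> x \<noteq> m" "x \<in> between V le u w \<Longrightarrow> w \<noteq> m"
proof -
  show x: "x \<noteq> m" if "x \<in> between V le u w"
    using m_max that by (auto simp: between_iff maxset_iff)
  show "w \<noteq> m" if b: "x \<in> between V le u w"
  proof
    assume "w = m"
    then have "m \<in> Lstar V le x" using b by (simp add: between_iff)
    then show False using x[OF b] b le_m_eq[of x] by (simp add: Lstar_iff between_iff)
  qed
qed

lemma U_between_imp:
  assumes "x \<in> between U R u w"
  shows "\<phi> x \<in> between V le (\<phi> u) (\<phi> w)"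
proof -
  have x: "x \<in> U" "Gstar U R x = {u}" "Lstar U R x = {w}" using assms by (auto simp: between_iff)
  have "\<phi> x \<noteq> m" using phi_up_image[OF x(1)] x(2) m_max by (auto simp: maxset_iff)
  then show ?thesis
    using x phi_up_image[OF x(1)] phi_down_image(1)[OF x(1)] phi_mem by (auto simp: between_iff)
qed

lemma U_between_Lstar:
  assumes "x \<in> U" "w \<in> U" "\<phi> x \<in> between V le v (\<phi> w)"
  shows "Lstar U R x = {w}"
proof -
  have x: "\<phi> x \<noteq> m" "\<phi> w \<noteq> m" using between_m assms(3) by blast+
  then have im: "\<phi> ` Lstar U R x = {\<phi> w}"
    using assms phi_down_image(1)[OF assms(1)] by (auto simp: between_iff)
  moreover have "y = w" if "y \<in> Lstar U R x" for y
  proof -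
    have "\<phi> y = \<phi> w" using im that by blast
    with x assms(2) that show ?thesis using phi_inj[of y w] by (simp add: Lstar_iff)
  qed
  ultimately show ?thesis by blast
qed

lemma U_between_not_m:
  assumes "u \<in> U" "w \<in> U" "\<phi> u \<noteq> m"
  shows "between U R u w = {x \<in> U. \<phi> x \<in> between V le (\<phi> u) (\<phi> w)}"
proof (intro equalityI subsetI)
  fix x assume x: "x \<in> {x \<in> U. \<phi> x \<in> between V le (\<phi> u) (\<phi> w)}"
  then have im: "\<phi> ` Gstar U R x = {\<phi> u}"
    using phi_up_image[of x] by (auto simp: between_iff)
  moreover have "y = u" if "y \<in> Gstar U R x" for y
  proof -
    have "\<phi> y = \<phi> u" using im that by blast
    with assms that show ?thesis using phi_inj[of y u] by (simp add: Gstar_iff)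
  qed
  ultimately have "Gstar U R x = {u}" by blast
  with x assms U_between_Lstar[of x w] show "x \<in> between U R u w" by (auto simp: between_iff)
qed (use U_between_imp in \<open>auto simp: between_iff\<close>)

text \<open>All nodes strictly above such an \<open>x\<close> lie over \<open>m\<close>. By
  \<open>D_disjoint\<close> only one of them has \<open>\<phi> x\<close> in its lower set.\<close>

lemma U_between_m:
  assumes "y \<in> N" "w \<in> U"
  shows "between U R y w = {x \<in> U. \<phi> x \<in> between V le m (\<phi> w) \<inter> D y}"
proof (intro equalityI subsetI)
  fix x assume x: "x \<in> between U R y w"
  then have "x \<in> U" "y \<in> Gstar U R x" by (auto simp: between_iff)
  moreover have "\<phi> y = m" using assms by (simp add: N_eq)
  ultimately have "\<phi> x \<in> D y" by (auto simp: R_def Gstar_iff)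
  then show "x \<in> {x \<in> U. \<phi> x \<in> between V le m (\<phi> w) \<inter> D y}"
    using U_between_imp[OF x] \<open>\<phi> y = m\<close> \<open>x \<in> U\<close> by simp
next
  fix x assume x: "x \<in> {x \<in> U. \<phi> x \<in> between V le m (\<phi> w) \<inter> D y}"
  then have im: "\<phi> ` Gstar U R x = {m}"
    using phi_up_image[of x] by (auto simp: between_iff)
  have "z = y" if "z \<in> Gstar U R x" for z
  proof -
    have "z \<in> N" using im that by (auto simp: N_eq Gstar_iff)
    then have "\<phi> x \<in> D z" using that by (auto simp: R_def Gstar_iff N_eq)
    then show ?thesis using D_disjoint[of "\<phi> x" "\<phi> w" z y] x assms(1) \<open>z \<in> N\<close> by blast
  qed
  with im have "Gstar U R x = {y}" by blast
  with x assms U_between_Lstar[of x w] show "x \<in> between U R y w" by (auto simp: between_iff)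
qed

lemma U_between_m_eqpoll:
  assumes "y \<in> N" "w \<in> U" "\<phi> w \<in> minset V le" "v \<in> D y" "\<phi> w \<in> Lstar V le v"
  shows "between U R y w \<approx> V"
proof -
  have "between U R y w \<approx> between V le m (\<phi> w) \<inter> D y"
    unfolding U_between_m[OF assms(1,2)]
    by (rule preimage_eqpoll) (use between_m(1) in \<open>auto simp: between_iff\<close>)
  also have "\<dots> \<approx> V" using D_large assms by blast
  finally show ?thesis .
qed

lemma infinite_between:
  assumes "u \<in> V" "v \<in> Lstar V le u" "w \<in> Lstar V le v"
  shows "infinite (between V le u w)" "infinite V"
proof -
  show "infinite (between V le u w)" using K assms unfolding K_poset_iff Lstar_iff by blast
  then show "infinite V" by (rule contrapos_nn) (auto simp: between_def)
qed

text \<open>The member \<open>x\<close> is itself a node strictly between \<open>w\<close> and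
  \<open>u\<close>, so the last K-poset axiom applies.\<close>

lemma infinite_between_nonempty:
  assumes "x \<in> between V le u w"
  shows "infinite (between V le u w)" "infinite V"
proof -
  have "u \<in> Gstar V le x" "w \<in> Lstar V le x" using assms by (auto simp: between_iff)
  then show "infinite (between V le u w)" "infinite V"
    using infinite_between[of u x w] assms by (auto simp: between_iff Gstar_iff Lstar_iff)
qed

lemma phi_Lstar:
  "y \<in> U \<Longrightarrow> x \<in> Lstar U R y \<Longrightarrow> \<phi> x \<in> Lstar V le (\<phi> y)"
  using R_le[of x y] R_strict[of x y] phi_mem[of x] by (auto simp: Lstar_iff)

section \<open>\<open>U\<close> is a proper K-poset and a splitting of \<open>V\<close>\<close>

lemma U_K_poset: "K_poset U R"
  unfolding K_poset_iff
proof (intro conjI ballI impI allI)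
  show "poset U R" by (rule U_poset)
  show "\<not> ht_ge U R 3 x" for x using ht_ge_phi K_poset_no_ht3[OF K] by blast
  have "minset U R \<subseteq> {x \<in> U. \<phi> x \<in> minset V le}"
    using U_minset by (auto simp: minset_iff)
  then show "finite (minset U R)"
    using finite_preimage[OF K_poset_finite_minset[OF K]] by (rule finite_subset)
  have "{x. ht_ge U R 2 x} \<subseteq> {x \<in> U. \<phi> x \<in> {u. ht_ge V le 2 u}}"
    using ht_ge_phi ht_ge_mem[of U R 2] by auto
  then show "finite {x. ht_ge U R 2 x}"
    using finite_preimage[OF K_poset_finite_ht2[OF K]] by (rule finite_subset)
next
  fix a b assume ab: "a \<in> minset U R" "b \<in> minset U R" "a \<noteq> b"
  then have abU: "a \<in> U" "b \<in> U" "\<phi> a \<in> minset V le" "\<phi> b \<in> minset V le"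
    using U_minset by (auto simp: minset_iff)
  then have "\<phi> a \<noteq> \<phi> b" using ab phi_inj[of a b] m_not_min by metis
  then have fin: "finite (insert m (mub V le {\<phi> a, \<phi> b}))"
    using K abU by (auto simp: K_poset_iff)
  \<comment> \<open>If \<open>x\<close> does not lie over \<open>m\<close>, a common upper bound
    \<open>w\<close> below \<open>\<phi> x\<close> differs from \<open>m\<close> and lifts to a
    common upper bound below \<open>x\<close>. The nodes over \<open>m\<close> add only a finite
    fibre.\<close>
  have "mub U R {a, b} \<subseteq> {x \<in> U. \<phi> x \<in> insert m (mub V le {\<phi> a, \<phi> b})}"
  proof
    fix x assume "x \<in> mub U R {a, b}"
    then have x: "x \<in> U" "R a x" "R b x" "\<And>z. z \<in> U \<Longrightarrow> R a z \<Longrightarrow> R b z \<Longrightarrow> R z x \<Longrightarrow> z = x"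
      by (auto simp: mub_def)
    have "w = \<phi> x" if xm: "\<phi> x \<noteq> m" and w: "w \<in> V" "le (\<phi> a) w" "le (\<phi> b) w" "le w (\<phi> x)" for w
    proof -
      obtain z where z: "z \<in> U" "w = \<phi> z" using obtain_preimage w(1) by blast
      have "w \<noteq> m" using le_m_eq w xm x(1) phi_mem by blast
      then have "R a z" "R b z" "R z x" using z w xm by (auto simp: R_def)
      with x(4) z show ?thesis by blast
    qed
    then show "x \<in> {x \<in> U. \<phi> x \<in> insert m (mub V le {\<phi> a, \<phi> b})}"
      using x R_le abU phi_mem by (auto simp: mub_def)
  qed
  then show "finite (mub U R {a, b})" using finite_preimage[OF fin] by (rule finite_subset)
next
  fix u v w assume U: "u \<in> U" "v \<in> U" "w \<in> U" and "R v u \<and> v \<noteq> u \<and> R w v \<and> w \<noteq> v"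
  then have L: "v \<in> Lstar U R u" "w \<in> Lstar U R v" by (auto simp: Lstar_iff)
  note L' = phi_mem[OF U(1)] phi_Lstar[OF U(1) L(1)] phi_Lstar[OF U(2) L(2)]
  show "infinite (between U R u w)"
  proof (cases "\<phi> u = m")
    case True
    then have "\<phi> v \<in> D u" using phi_down_image(1)[OF U(1)] L by auto
    moreover have "\<phi> w \<in> minset V le" using K_poset_chain3_minset[OF K L'] .
    ultimately have "between U R u w \<approx> V" using U_between_m_eqpoll[of u w] U True L' by (simp add: N_eq)
    then show ?thesis using infinite_between(2)[OF L'] eqpoll_finite_iff by blast
  next
    case False
    have "between U R u w \<approx> between V le (\<phi> u) (\<phi> w)"
      unfolding U_between_not_m[OF U(1,3) False]
      by (rule preimage_eqpoll) (use between_m(1) in \<open>auto simp: between_iff\<close>)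
    then show ?thesis using infinite_between(1)[OF L'] eqpoll_finite_iff by blast
  qed
qed

lemma U_proper: "proper_K_poset U R"
  unfolding proper_K_poset_def
proof (intro conjI ballI)
  fix u w assume "u \<in> maxset U R" "w \<in> minset U R"
  moreover from this have U: "u \<in> U" "w \<in> U" by (auto simp: minset_def maxset_def)
  ultimately have V: "\<phi> u \<in> maxset V le" "\<phi> w \<in> minset V le"
    using U_minset U_maxset by blast+
  have "between U R u w \<approx> U" if x: "x \<in> between U R u w" for x
  proof -
    have xV: "\<phi> x \<in> between V le (\<phi> u) (\<phi> w)" using U_between_imp[OF x] .
    have inf: "infinite V" using infinite_between_nonempty(2)[OF xV] .
    have "between U R u w \<approx> V"
    proof (cases "\<phi> u = m")
      case True
      \<comment> \<open>The member \<open>x\<close> provides the element of \<open>D u\<close> above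
        \<open>\<phi> w\<close> that \<open>D_large\<close> asks for.\<close>
      then have "\<phi> x \<in> D u" using x U_between_m[of u w] U by (auto simp: N_eq)
      then show ?thesis
        using U_between_m_eqpoll[of u w] U True xV V by (simp add: N_eq between_iff)
    next
      case False
      have "between U R u w \<approx> between V le (\<phi> u) (\<phi> w)"
        unfolding U_between_not_m[OF U False]
        by (rule preimage_eqpoll) (use between_m(1) in \<open>auto simp: between_iff\<close>)
      also have "\<dots> \<approx> V" using proper V xV unfolding proper_K_poset_def by blast
      finally show ?thesis .
    qed
    also have "V \<approx> U" using U_eqpoll_V[OF inf] by (rule eqpoll_sym)
    finally show ?thesis .
  qed
  then show "between U R u w = {} \<or> between U R u w \<approx> U" by blast
qed (rule U_K_poset)

lemma U_splitting: "splitting U R V le m"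
  unfolding splitting_def
proof (intro conjI exI[of _ N] exI[of _ \<phi>] ballI impI)
  show "0 < height V le m" using height_pos_iff[OF V_poset m_mem] m_not_min by blast
  show "N \<noteq> {}" using obtain_preimage[OF m_mem] by (auto simp: N_eq)
  show "N \<subseteq> maxset U R" using U_maxset m_max by (auto simp: N_eq)
  show "0 < height U R x" if "x \<in> N" for x
    using that height_pos_iff[OF U_poset, of x] U_minset[of x] m_not_min by (simp add: N_eq)
  show "le (\<phi> x) (\<phi> y)" if "x \<in> U" "y \<in> U" "R x y" for x y
    using R_le that .
  show "card {x \<in> U. \<phi> x = v} = 1" if "v \<in> V" "v \<noteq> m" for v
  proof -
    obtain x where x: "x \<in> U" "\<phi> x = v" using obtain_preimage \<open>v \<in> V\<close> by blast
    have "y = x" if "y \<in> U" "\<phi> y = v" for y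
      using phi_inj[of y x] that x \<open>v \<noteq> m\<close> by simp
    with x have "{y \<in> U. \<phi> y = v} = {x}" by blast
    then show ?thesis by simp
  qed
  show "\<exists>y\<in>U. R x y \<and> \<phi> y = v" if "x \<in> U" "v \<in> V" "le (\<phi> x) v" for x v
    using lift_up that .
qed (use V_poset U_poset m_max finite_N image N_eq in auto)

section \<open>Bad nodes of \<open>U\<close>\<close>

text \<open>Nodes over \<open>m\<close> are excluded because they may have fewer minimal nodes below
  them than \<open>m\<close> has.\<close>

lemma U_two_min:
  assumes "x \<in> U" "\<phi> x \<noteq> m"
  shows "two_min U R x \<longleftrightarrow> two_min V le (\<phi> x)"
proof
  assume "two_min U R x"
  then obtain a b where ab: "a \<in> minset U R" "b \<in> minset U R" "a \<noteq> b" "R a x" "R b x"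
    by (auto simp: two_min_def)
  then have "a \<in> U" "b \<in> U" by (auto simp: minset_def)
  moreover from this have "\<phi> a \<in> minset V le" "\<phi> b \<in> minset V le" using ab U_minset by auto
  moreover from calculation have "\<phi> a \<noteq> \<phi> b" using ab phi_inj[of a b] m_not_min by metis
  ultimately show "two_min V le (\<phi> x)"
    unfolding two_min_def using ab assms R_le by metis
next
  assume "two_min V le (\<phi> x)"
  then obtain a b where ab: "a \<in> minset V le" "b \<in> minset V le" "a \<noteq> b" "le a (\<phi> x)" "le b (\<phi> x)"
    by (auto simp: two_min_def)
  then obtain a' b' where "a' \<in> U" "b' \<in> U" "\<phi> a' = a" "\<phi> b' = b"
    using obtain_preimage by (metis minset_iff)
  with ab assms U_minset have "a' \<in> minset U R" "b' \<in> minset U R" "a' \<noteq> b'" "R a' x" "R b' x"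
    by (auto simp: R_def)
  then show "two_min U R x" unfolding two_min_def by blast
qed

text \<open>On a strict lower set, which contains no node over \<open>m\<close>, the map
  \<open>\<phi>\<close> is injective and respects the order, minimality and \<open>two_min\<close>.
  It therefore carries one \<open>lam\<close> onto the other.\<close>

lemma card_lam_U:
  assumes "x \<in> U"
  shows "card (lam U R (Lstar U R x)) = card (lam V le (if \<phi> x = m then D x else Lstar V le (\<phi> x)))"
    (is "_ = card (lam V le ?E)")
proof -
  let ?L = "Lstar U R x"
  have nm: "\<phi> y \<noteq> m" "y \<in> U" if "y \<in> ?L" for y
    using that phi_down_image(3)[OF assms] by (auto simp: Lstar_iff)
  have E: "?E = \<phi> ` ?L" using phi_down_image(1)[OF assms] by simp
  have tm: "two_min V le (\<phi> y) \<longleftrightarrow> two_min U R y" if "y \<in> ?L" for y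
    using U_two_min nm[OF that] by blast
  have mn: "\<phi> y \<in> minset V le \<longleftrightarrow> y \<in> minset U R" if "y \<in> ?L" for y
    using U_minset nm[OF that] by blast
  have le: "le (\<phi> y) (\<phi> z) \<longleftrightarrow> R y z" if "y \<in> ?L" "z \<in> ?L" for y z
    using nm[OF that(2)] by (simp add: R_def)
  have "lam V le ?E = \<phi> ` lam U R ?L"
    unfolding E lam_def using tm mn le by auto
  moreover have "inj_on \<phi> (lam U R ?L)"
    by (rule inj_on_subset[OF phi_down_image(2)[OF assms]]) (auto simp: lam_def)
  ultimately show ?thesis by (simp add: card_image)
qed

text \<open>By \<open>D_lam\<close> no node over \<open>m\<close> is bad, and elsewhere badness is
  unchanged. So \<open>\<phi>\<close> embeds the bad nodes of \<open>U\<close> into those of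
  \<open>V\<close> other than \<open>m\<close>.\<close>

lemma card_bad_set_U:
  assumes "m \<in> bad_set V le"
  shows "card (bad_set U R) < card (bad_set V le)"
proof -
  have "x \<in> U \<and> \<phi> x \<in> bad_set V le - {m}" if x: "x \<in> bad_set U R" for x
  proof -
    have xU: "x \<in> U" using x by (auto simp: bad_set_def maxset_def)
    have "\<phi> x \<noteq> m"
      using x card_lam_U[OF xU] D_lam[of x] xU by (auto simp: bad_set_def N_eq)
    then show ?thesis
      using x card_lam_U[OF xU] U_maxset[OF xU] U_minset[OF xU] xU by (auto simp: bad_set_def)
  qed
  then have "inj_on \<phi> (bad_set U R)" "\<phi> ` bad_set U R \<subseteq> bad_set V le - {m}"
    using phi_inj unfolding inj_on_def by blast+
  then have "card (bad_set U R) \<le> card (bad_set V le - {m})"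
    using finite_bad_set[OF K] by (meson card_inj_on_le finite_Diff)
  also have "\<dots> < card (bad_set V le)"
    using finite_bad_set[OF K] assms by (rule card_Diff1_less)
  finally show ?thesis .
qed

end

subsection \<open>Simplification\<close>

text \<open>Anything below \<open>w\<close> is strictly below \<open>x\<close>, hence equal to
  \<open>w\<close>. So \<open>w\<close> is minimal and the only minimal node below
  \<open>x\<close>.\<close>

lemma minimal_of_between:
  assumes "poset V le" "x \<in> between V le u w"
  shows "w \<in> minset V le" "x \<notin> minset V le" "\<not> two_min V le x"
    "w' \<in> minset V le \<Longrightarrow> le w' x \<Longrightarrow> w' = w"
proof -
  have x: "x \<in> V" "Lstar V le x = {w}" using assms(2) by (auto simp: between_iff)
  then have w: "w \<in> V" "le w x" "w \<noteq> x" using Lstar_iff[of w V le x] by auto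
  have "v = w" if v: "v \<in> V" "le v w" for v
  proof -
    have "le v x" using poset_trans[OF assms(1), of v w x] v w x by blast
    moreover have "v \<noteq> x" using poset_antisym[OF assms(1), of x w] v w x by blast
    ultimately have "v \<in> Lstar V le x" using v by (simp add: Lstar_iff)
    with x show ?thesis by simp
  qed
  with w show "w \<in> minset V le" by (auto simp: minset_def)
  show nx: "x \<notin> minset V le" using x by (simp add: minset_iff)
  show eq: "v = w" if "v \<in> minset V le" "le v x" for v
  proof -
    have "v \<in> Lstar V le x" using that nx by (auto simp: Lstar_iff minset_def)
    with x show ?thesis by simp
  qed
  show "\<not> two_min V le x" using eq unfolding two_min_def by blast
qed

text \<open>This provides the assumptions on \<open>D\<close> in \<open>lower_set_splitting\<close>.
  Only the size of \<open>N\<close> is prescribed, which leaves the names of the new nodes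
  free.\<close>

lemma lower_sets_exist:
  assumes proper: "proper_K_poset V le"
    and m: "m \<in> maxset V le" "m \<notin> minset V le"
    and N: "finite N" "card N = card (lam V le (Lstar V le m))"
  obtains D where
    "\<And>y. y \<in> N \<Longrightarrow> D y \<subseteq> Lstar V le m"
    "\<And>y v x. y \<in> N \<Longrightarrow> v \<in> D y \<Longrightarrow> x \<in> V \<Longrightarrow> le x v \<Longrightarrow> x \<in> D y"
    "\<And>y. y \<in> N \<Longrightarrow> D y \<noteq> {}"
    "\<And>x. x \<in> Lstar V le m \<Longrightarrow> \<exists>y\<in>N. x \<in> D y"
    "\<And>x w y z. x \<in> between V le m w \<Longrightarrow> y \<in> N \<Longrightarrow> z \<in> N \<Longrightarrow> x \<in> D y \<Longrightarrow> x \<in> D z \<Longrightarrow> y = z"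
    "\<And>y w v. y \<in> N \<Longrightarrow> w \<in> minset V le \<Longrightarrow> v \<in> D y \<Longrightarrow> w \<in> Lstar V le v \<Longrightarrow>
       between V le m w \<inter> D y \<approx> V"
    "\<And>y. y \<in> N \<Longrightarrow> card (lam V le (D y)) = 1"
proof -
  have K: "K_poset V le" using proper by (simp add: proper_K_poset_def)
  note P = K_poset_poset[OF K]
  note refl = poset_refl[OF P] and antisym = poset_antisym[OF P] and trans = poset_trans[OF P]
  have mV: "m \<in> V" using m by (simp add: maxset_def)
  let ?L = "Lstar V le m" and ?Mn = "minset V le"
  let ?\<Lambda> = "lam V le ?L"
  have \<Lambda>L: "?\<Lambda> \<subseteq> ?L" by (auto simp: lam_def)
  obtain \<kappa> where \<kappa>: "bij_betw \<kappa> N ?\<Lambda>"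
    using finite_same_card_bij[OF N(1) finite_lam[OF K mV] N(2)] by blast
  have \<kappa>\<Lambda>: "\<kappa> y \<in> ?\<Lambda>" if "y \<in> N" for y using bij_betwE[OF \<kappa>] that by blast
  have \<kappa>L: "\<kappa> y \<in> V" "le (\<kappa> y) m" "\<kappa> y \<noteq> m" if "y \<in> N" for y
    using \<kappa>\<Lambda>[OF that] \<Lambda>L Lstar_iff[of "\<kappa> y" V le m] by blast+
  have \<kappa>_onto: "\<exists>y\<in>N. v = \<kappa> y" if "v \<in> ?\<Lambda>" for v
    using \<kappa> that unfolding bij_betw_def by blast
  have below_min: "x \<in> ?Mn" if "v \<in> ?L" "x \<in> V" "le x v" "x \<noteq> v" for x v
    using K_poset_chain3_minset[OF K mV that(1), of x] that by (simp add: Lstar_iff)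
  have Lstar_down: "x \<in> ?L" if "v \<in> ?L" "x \<in> V" "le x v" for x v
    using that trans[of x v m] antisym[of v m] mV by (auto simp: Lstar_iff)
  have inf: "infinite (between V le m w) \<or> between V le m w = {}" for w
  proof (cases "between V le m w = {}")
    case False
    then obtain x where x: "x \<in> between V le m w" by blast
    then have "x \<in> V" "m \<in> Gstar V le x" "w \<in> Lstar V le x" by (auto simp: between_iff)
    then have "infinite (between V le m w)"
      using K mV unfolding K_poset_iff Lstar_iff Gstar_iff by metis
    then show ?thesis ..
  qed simp
  \<comment> \<open>The new nodes that may receive nodes over \<open>w\<close>. Requiring
    \<open>w\<close> below \<open>\<kappa> y\<close> keeps \<open>D y\<close> downward closed
    without adding minimal nodes to those below \<open>\<kappa> y\<close>.\<close>
  let ?F = "\<lambda>w. {y \<in> N. le w (\<kappa> y)}"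
  have F_ne: "?F w \<noteq> {}" if "w \<in> ?Mn \<inter> ?L" for w
    using lam_above_minimal[OF K, of w m] that \<kappa>_onto by blast
  have "\<forall>w\<in>?Mn \<inter> ?L. \<exists>f. (\<forall>x. f x \<in> ?F w) \<and>
      (\<forall>y\<in>?F w. {x\<in>between V le m w. f x = y} \<approx> between V le m w)"
  proof
    fix w assume "w \<in> ?Mn \<inter> ?L"
    from infinite_partition_eqpoll[OF inf _ F_ne[OF this], of w] N(1)
    show "\<exists>f. (\<forall>x. f x \<in> ?F w) \<and>
        (\<forall>y\<in>?F w. {x\<in>between V le m w. f x = y} \<approx> between V le m w)" by simp
  qed
  from bchoice[OF this] obtain f where f': "\<forall>w\<in>?Mn \<inter> ?L. (\<forall>x. f w x \<in> ?F w) \<and>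
      (\<forall>y\<in>?F w. {x\<in>between V le m w. f w x = y} \<approx> between V le m w)" ..
  \<comment> \<open>This holds for every \<open>x\<close>, not only for members of
    \<open>between V le m w\<close>: a node over \<open>w\<close> with maximal nodes other than
    \<open>m\<close> above it needs a place too.\<close>
  have f: "f w x \<in> ?F w" if "w \<in> ?Mn \<inter> ?L" for w x
    using bspec[OF f' that] by (rule conjunct1[THEN spec])
  have f_part: "{x\<in>between V le m w. f w x = y} \<approx> between V le m w"
    if "w \<in> ?Mn \<inter> ?L" "y \<in> ?F w" for w y
    using bspec[OF f' that(1)] that(2) by blast
  \<comment> \<open>The quantifier over \<open>w\<close> involves no choice, as exactly one minimal
    node lies below such an \<open>x\<close>. Nodes with \<open>two_min\<close> are left out because
    they are values of \<open>\<kappa>\<close>.\<close>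
  define P where "P y = {x \<in> ?L - ?Mn. \<not> two_min V le x \<and> (\<exists>w\<in>?Mn. le w x \<and> f w x = y)}" for y
  define D where "D y = {x \<in> V. le x (\<kappa> y)} \<union> P y" for y
  have base: "w \<in> ?Mn \<inter> ?L" if "w \<in> ?Mn" "x \<in> ?L" "le w x" for w x
    using Lstar_down[of x w] that by (auto simp: minset_def)
  have below: "D y \<subseteq> ?L" if "y \<in> N" for y
    using Lstar_down[of "\<kappa> y"] \<kappa>\<Lambda>[OF that] \<Lambda>L by (auto simp: D_def P_def)
  have \<kappa>D: "\<kappa> y \<in> D y" if "y \<in> N" for y
    using refl \<kappa>L[OF that] by (simp add: D_def)
  have min_D: "le w (\<kappa> y)" if "w \<in> ?Mn" "w \<in> D y" for w y
    using that by (auto simp: D_def P_def)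
  have down: "x \<in> D y" if y: "y \<in> N" and v: "v \<in> D y" and x: "x \<in> V" "le x v" for y v x
  proof (cases "x = v \<or> le v (\<kappa> y)")
    case True
    then show ?thesis
      using v x trans[of x v "\<kappa> y"] \<kappa>L[OF y] below[OF y] by (auto simp: D_def Lstar_iff)
  next
    case False
    then have xv: "x \<noteq> v" and "v \<in> P y" using v by (auto simp: D_def)
    then obtain w where w: "w \<in> ?Mn" "le w v" "f w v = y" "\<not> two_min V le v" and vL: "v \<in> ?L"
      by (auto simp: P_def)
    \<comment> \<open>As \<open>v\<close> is not \<open>two_min\<close>, the minimal node
      \<open>x\<close> must be the \<open>w\<close> that sent \<open>v\<close> to \<open>y\<close>,
      and this \<open>w\<close> lies below \<open>\<kappa> y\<close>.\<close>
    have "x \<in> ?Mn" using below_min[OF vL x xv] .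
    then have "x = w" using w x unfolding two_min_def by blast
    moreover have "le w (\<kappa> y)" using f[OF base[OF w(1) vL w(2)], of v] w by simp
    ultimately show ?thesis using x by (simp add: D_def)
  qed
  have cover: "\<exists>y\<in>N. x \<in> D y" if x: "x \<in> ?L" for x
  proof -
    have xV: "x \<in> V" using x by (simp add: Lstar_iff)
    obtain w where w: "w \<in> ?Mn" "le w x" using K_poset_minimal_below[OF K xV] by blast
    note wL = base[OF w(1) x w(2)]
    consider "x \<in> ?Mn" | "two_min V le x" | "x \<notin> ?Mn" "\<not> two_min V le x" by blast
    then show ?thesis
    proof cases
      case 1
      then obtain y where "y \<in> N" "le x (\<kappa> y)" using F_ne[of x] x by blast
      then show ?thesis using xV by (auto simp: D_def)
    next
      case 2
      then have "x \<in> ?\<Lambda>" using x by (simp add: lam_def)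
      then show ?thesis using \<kappa>_onto \<kappa>D by blast
    next
      case 3
      then have "x \<in> P (f w x)" using x w by (auto simp: P_def)
      moreover have "f w x \<in> N" using f[OF wL] by blast
      ultimately show ?thesis by (auto simp: D_def)
    qed
  qed
  have between_D: "x \<in> D y \<longleftrightarrow> f w x = y" if y: "y \<in> N" and x: "x \<in> between V le m w" for x y w
  proof -
    note b = minimal_of_between[OF P x]
    have xV: "x \<in> V" and G: "Gstar V le x = {m}" and L: "Lstar V le x = {w}"
      using x by (auto simp: between_iff)
    have wx: "le w x" and xL: "x \<in> ?L"
      using xV G L Lstar_iff[of w V le x] Gstar_iff[of m V le x] by (auto simp: Lstar_iff)
    \<comment> \<open>The node \<open>x\<close> is neither minimal nor \<open>two_min\<close>, so it
      differs from \<open>\<kappa> y\<close>; and the only node strictly above \<open>x\<close> is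
      \<open>m\<close>. Hence \<open>x\<close> can enter \<open>D y\<close> only through
      \<open>P y\<close>.\<close>
    have "\<not> le x (\<kappa> y)"
    proof
      assume "le x (\<kappa> y)"
      moreover have "x \<noteq> \<kappa> y" using \<kappa>\<Lambda>[OF y] b(2,3) by (auto simp: lam_def)
      ultimately have "\<kappa> y \<in> Gstar V le x" using \<kappa>L[OF y] by (auto simp: Gstar_iff)
      with G \<kappa>L[OF y] show False by simp
    qed
    then have "x \<in> D y \<longleftrightarrow> (\<exists>v\<in>?Mn. le v x \<and> f v x = y)"
      using xL b(2,3) by (simp add: D_def P_def)
    also have "\<dots> \<longleftrightarrow> f w x = y" using b(1,4) wx by blast
    finally show ?thesis .
  qed
  have large: "between V le m w \<inter> D y \<approx> V"
    if y: "y \<in> N" and w: "w \<in> ?Mn" and v: "v \<in> D y" "w \<in> Lstar V le v" for y w v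
  proof -
    have vL: "v \<in> ?L" using below y v by blast
    have wv: "w \<in> V" "le w v" "w \<noteq> v" using v by (auto simp: Lstar_iff)
    have wD: "w \<in> D y" using down[OF y v(1)] wv by blast
    have yF: "y \<in> ?F w" using min_D[OF w wD] y by simp
    have "infinite (between V le m w)"
      using K mV vL wv unfolding K_poset_iff Lstar_iff by blast
    then have "between V le m w \<approx> V"
      using proper m(1) w unfolding proper_K_poset_def by fastforce
    moreover have "between V le m w \<inter> D y = {x\<in>between V le m w. f w x = y}"
      using between_D[OF y] by blast
    ultimately show ?thesis
      using f_part[OF base[OF w vL wv(2)] yF] eqpoll_trans by metis
  qed
  have simple: "card (lam V le (D y)) = 1" if y: "y \<in> N" for y
  proof -
    have \<kappa>y: "\<kappa> y \<in> ?L" using \<kappa>\<Lambda>[OF y] \<Lambda>L by blast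
    have nm: "\<kappa> y \<in> ?Mn" if "\<not> two_min V le (\<kappa> y)"
      using \<kappa>\<Lambda>[OF y] that by (simp add: lam_def)
    have two: "u = \<kappa> y" if u: "u \<in> D y" "two_min V le u" for u
    proof (rule ccontr)
      assume "u \<noteq> \<kappa> y"
      moreover have "u \<in> V" "le u (\<kappa> y)" using u by (auto simp: D_def P_def)
      ultimately have "u \<in> ?Mn" using below_min[OF \<kappa>y] by blast
      with u two_min_not_min show False by metis
    qed
    \<comment> \<open>If \<open>\<kappa> y\<close> is \<open>two_min\<close>, all minimal nodes of
      \<open>D y\<close> lie below it and drop out. Otherwise it is minimal and the only minimal
      node of \<open>D y\<close>.\<close>
    have "lam V le (D y) = {\<kappa> y}"
    proof (intro equalityI subsetI)
      fix u assume u: "u \<in> lam V le (D y)"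
      show "u \<in> {\<kappa> y}"
      proof (cases "two_min V le u")
        case True
        then show ?thesis using u two by (auto simp: lam_def)
      next
        case False
        then have uD: "u \<in> D y" "u \<in> ?Mn" "\<forall>v\<in>D y. two_min V le v \<longrightarrow> \<not> le u v"
          using u by (auto simp: lam_def)
        then have "le u (\<kappa> y)" using min_D by blast
        with uD have "\<kappa> y \<in> ?Mn" using nm \<kappa>D[OF y] by blast
        with \<open>le u (\<kappa> y)\<close> uD have "u = \<kappa> y" by (simp add: minset_def)
        then show ?thesis by simp
      qed
    next
      fix u assume "u \<in> {\<kappa> y}"
      then show "u \<in> lam V le (D y)"
        using \<kappa>\<Lambda>[OF y] \<kappa>D[OF y] below[OF y] unfolding lam_def by blast
    qed
    then show ?thesis by simp
  qed
  show thesis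
  proof (rule that[of D])
    show "D y \<noteq> {}" if "y \<in> N" for y using \<kappa>D[OF that] by blast
    show "y = z" if "x \<in> between V le m w" "y \<in> N" "z \<in> N" "x \<in> D y" "x \<in> D z" for x w y z
      using that between_D by metis
  qed (fact below down cover large simple)+
qed

text \<open>Only the order is constructed. The carrier and \<open>\<phi>\<close> are parameters
  because the two applications name the new nodes differently.\<close>

lemma bad_node_splitting:
  assumes proper: "proper_K_poset V le" and m: "m \<in> bad_set V le"
    and image: "\<phi> ` U = V" and inj: "inj_on \<phi> {x \<in> U. \<phi> x \<noteq> m}"
    and fin: "finite {x \<in> U. \<phi> x = m}"
    and card: "card {x \<in> U. \<phi> x = m} = card (lam V le (Lstar V le m))"
  shows "\<exists>R. splitting U R V le m \<and> proper_K_poset U R \<and> card (bad_set U R) < card (bad_set V le)"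
proof -
  have m': "m \<in> maxset V le" "m \<notin> minset V le" using m by (auto simp: bad_set_def)
  have "U - {x \<in> U. \<phi> x = m} = {x \<in> U. \<phi> x \<noteq> m}" by blast
  then have inj': "inj_on \<phi> (U - {x \<in> U. \<phi> x = m})" using inj by simp
  obtain D where "lower_set_splitting V le m U \<phi> D {x \<in> U. \<phi> x = m}"
  proof (rule lower_sets_exist[OF proper m' fin card], goal_cases)
    case (1 D)
    show ?case
      by (rule that, unfold_locales) (rule refl | fact proper m' image inj' fin 1)+
  qed
  then interpret lower_set_splitting V le m U \<phi> D "{x \<in> U. \<phi> x = m}" .
  show ?thesis using U_splitting U_proper card_bad_set_U[OF m] by blast
qed

section \<open>Iterated splittings\<close>

text \<open>Carrier and order are paired so that finite sequences of splittings form a reflexive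
  transitive closure.\<close>

definition splitting_step ::
    "'a set \<times> ('a \<Rightarrow> 'a \<Rightarrow> bool) \<Rightarrow> 'a set \<times> ('a \<Rightarrow> 'a \<Rightarrow> bool) \<Rightarrow> bool" where
  "splitting_step P Q \<longleftrightarrow>
     proper_K_poset (fst Q) (snd Q) \<and> (\<exists>n. splitting (fst Q) (snd Q) (fst P) (snd P) n)"

text \<open>The complement of the carrier supplies the names of the new nodes, so that every later
  splitting stays within the same type.\<close>

lemma simplification_within_type:
  fixes V :: "'a set"
  assumes "proper_K_poset V le" "infinite (- V)"
  shows "\<exists>U R. splitting_step\<^sup>*\<^sup>* (V, le) (U, R) \<and> simple_poset U R"
  using assms
proof (induction "card (bad_set V le)" arbitrary: V le rule: less_induct)
  case less
  show ?case
  proof (cases "bad_set V le = {}")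
    case True
    then show ?thesis using less.prems by (auto simp: simple_poset_iff)
  next
    case False
    then obtain m where m: "m \<in> bad_set V le" by blast
    then have mV: "m \<in> V" by (auto simp: bad_set_def maxset_def)
    let ?c = "card (lam V le (Lstar V le m))"
    have K: "K_poset V le" using less.prems by (simp add: proper_K_poset_def)
    have c: "?c \<noteq> 0"
      using lam_nonempty[OF K mV] finite_lam[OF K mV] m by (simp add: bad_set_def)
    obtain N where N: "finite N" "card N = ?c" "N \<subseteq> - V"
      using infinite_arbitrarily_large[OF less.prems(2)] by blast
    define \<phi> where "\<phi> x = (if x \<in> N then m else x)" for x
    let ?U = "N \<union> (V - {m})"
    have fib: "{x \<in> ?U. \<phi> x = m} = N" "{x \<in> ?U. \<phi> x \<noteq> m} = V - {m}"
      using N(3) mV by (auto simp: \<phi>_def)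
    have "N \<noteq> {}" using N c by auto
    then have "\<phi> ` ?U = V" using N(3) mV by (auto simp: \<phi>_def image_iff)
    moreover have "inj_on \<phi> (V - {m})" using N(3) by (auto simp: \<phi>_def inj_on_def)
    ultimately obtain R where R: "splitting ?U R V le m" "proper_K_poset ?U R"
        "card (bad_set ?U R) < card (bad_set V le)"
      using bad_node_splitting[OF less.prems(1) m, of \<phi> ?U] N unfolding fib by blast
    have "- V \<subseteq> N \<union> - ?U" by blast
    then have "infinite (- ?U)" using less.prems(2) N(1) finite_subset by blast
    from less.hyps[OF R(3,2) this] obtain W S
      where "splitting_step\<^sup>*\<^sup>* (?U, R) (W, S)" "simple_poset W S" by blast
    moreover have "splitting_step (V, le) (?U, R)" using R by (auto simp: splitting_step_def)
    ultimately show ?thesis by (blast intro: converse_rtranclp_into_rtranclp)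
  qed
qed

lemma simplification_first_step:
  fixes V :: "'a set"
  assumes proper: "proper_K_poset V le" and m: "m \<in> bad_set V le"
  shows "\<exists>(U :: ('a \<times> nat) set) R. splitting U R V le m \<and> proper_K_poset U R \<and> infinite (- U)"
proof -
  have mV: "m \<in> V" using m by (auto simp: bad_set_def maxset_def)
  let ?c = "card (lam V le (Lstar V le m))"
  have K: "K_poset V le" using proper by (simp add: proper_K_poset_def)
  have c: "?c \<noteq> 0"
    using lam_nonempty[OF K mV] finite_lam[OF K mV] m by (simp add: bad_set_def)
  let ?U = "{m} \<times> {..<?c} \<union> (V - {m}) \<times> {0}"
  have fib: "{x \<in> ?U. fst x = m} = {m} \<times> {..<?c}" "{x \<in> ?U. fst x \<noteq> m} = (V - {m}) \<times> {0}"
    by auto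
  have "fst ` ?U = V" using c mV by (auto simp: image_Un image_iff)
  moreover have "inj_on fst ((V - {m}) \<times> {0 :: nat})" by (auto simp: inj_on_def)
  ultimately obtain R where R: "splitting ?U R V le m" "proper_K_poset ?U R"
    using bad_node_splitting[OF proper m, of fst ?U] unfolding fib by (auto simp: card_cartesian_product)
  have "Pair m ` {?c..} \<subseteq> - ?U" using c by auto
  moreover have "infinite (Pair m ` {?c..})"
    by (simp add: finite_image_iff inj_on_def infinite_Ici)
  ultimately have "infinite (- ?U)" using finite_subset by blast
  with R show ?thesis by blast
qed

text \<open>\<open>V\<close> has type \<open>'a set\<close>, while the later carriers consist of
  pairs. Hence \<open>l = 0\<close> is a separate case and the first splitting stands apart from the
  others.\<close>

theorem theorem5p6:
  fixes V :: "'a set" and le :: "'a \<Rightarrow> 'a \<Rightarrow> bool"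
  assumes "proper_K_poset V le"
  shows "\<exists>(l::nat) (W :: nat \<Rightarrow> ('a \<times> nat) set) (R :: nat \<Rightarrow> ('a \<times> nat) \<Rightarrow> ('a \<times> nat) \<Rightarrow> bool)
            (n1 :: 'a) (ns :: nat \<Rightarrow> 'a \<times> nat).
           (l = 0 \<and> simple_poset V le) \<or>
           (l \<ge> 1 \<and>
            (\<forall>i\<in>{1..l}. proper_K_poset (W i) (R i)) \<and>
            splitting (W 1) (R 1) V le n1 \<and>
            (\<forall>i\<in>{2..l}. splitting (W i) (R i) (W (i - 1)) (R (i - 1)) (ns i)) \<and>
            simple_poset (W l) (R l))"
proof (cases "bad_set V le = {}")
  case True
  then show ?thesis using assms by (auto simp: simple_poset_iff)
next
  case False
  then obtain m where m: "m \<in> bad_set V le" by blast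
  obtain U :: "('a \<times> nat) set" and S
    where U: "splitting U S V le m" "proper_K_poset U S" "infinite (- U)"
    using simplification_first_step[OF assms m] by blast
  obtain U' S' where step: "splitting_step\<^sup>*\<^sup>* (U, S) (U', S')" and simple: "simple_poset U' S'"
    using simplification_within_type[OF U(2,3)] by blast
  obtain k f where f: "f 0 = (U, S)" "f k = (U', S')" "\<And>i. i < k \<Longrightarrow> splitting_step (f i) (f (Suc i))"
    using step unfolding rtranclp_power relpowp_fun_conv by blast
  then have "\<forall>i. \<exists>n. i < k \<longrightarrow>
      splitting (fst (f (Suc i))) (snd (f (Suc i))) (fst (f i)) (snd (f i)) n"
    unfolding splitting_step_def by blast
  then obtain n where n: "\<And>i. i < k \<Longrightarrow>
      splitting (fst (f (Suc i))) (snd (f (Suc i))) (fst (f i)) (snd (f i)) (n i)"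
    by metis
  \<comment> \<open>\<open>f 0\<close> is the result of the first splitting, which has index one in
    the statement. Hence the shift \<open>i - 1\<close>, and the node split to reach
    \<open>?W i\<close> is \<open>n (i - 2)\<close>.\<close>
  let ?W = "\<lambda>i. fst (f (i - 1))" and ?R = "\<lambda>i. snd (f (i - 1))"
  have "proper_K_poset (?W i) (?R i)" if "i \<in> {1..Suc k}" for i
  proof (cases "i - 1")
    case 0
    then show ?thesis using U f(1) by simp
  next
    case (Suc j)
    then have "j < k" using that by auto
    then show ?thesis using f(3) Suc by (auto simp: splitting_step_def)
  qed
  moreover have "splitting (?W i) (?R i) (?W (i - 1)) (?R (i - 1)) (n (i - 2))"
    if "i \<in> {2..Suc k}" for i
  proof -
    obtain j where "i = Suc (Suc j)" using \<open>i \<in> {2..Suc k}\<close> by (cases i; cases "i - 1") auto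
    then show ?thesis using n[of j] that by simp
  qed
  ultimately have "Suc k \<ge> 1 \<and>
      (\<forall>i\<in>{1..Suc k}. proper_K_poset (?W i) (?R i)) \<and>
      splitting (?W 1) (?R 1) V le m \<and>
      (\<forall>i\<in>{2..Suc k}. splitting (?W i) (?R i) (?W (i - 1)) (?R (i - 1)) (n (i - 2))) \<and>
      simple_poset (?W (Suc k)) (?R (Suc k))"
    using U f simple by simp
  then show ?thesis
    by (intro exI[of _ "Suc k"] exI[of _ ?W] exI[of _ ?R] exI[of _ m] exI[of _ "\<lambda>i. n (i - 2)"]
        disjI2)
qed

end
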